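(* Let $V$ be a MOSVA and $W$ a $V$-bimodule, both satisfying the pole-order condition, let $n\in\mathbb Z_+$, $v_1,v_2\in V$, and let $f\in\widetilde W_{z_3,\dots,z_{n+2}}$ be such that for every $(z_1,\dots,z_{n+2})\in F_{n+2}\mathbb C$ with $|z_1|>|z_2|>|z_i|$, $i=3,\dots,n+2$, the series $$Y_W^L(v_1,z_1)Y_W^L(v_2,z_2)f(z_3,\dots,z_{n+2})$$ converges absolutely to a $\overline W$-valued rational function. Then for every $(z_1,\dots,z_{n+2})\in F_{n+2}\mathbb C$ with $|z_2|>|z_1-z_2|+|z_i|$, $i=3,\dots,n+2$, the series $$Y_W^L(Y_V(v_1,z_1-z_2)v_2,z_2)f(z_3,\dots,z_{n+2})$$ also converges absolutely to the same $\overline W$-valued rational function.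
   Context: All vector spaces are over $\mathbb{C}$; $\mathbb{Z}_+=\{1,2,\dots\}$. **MOSVA.** A meromorphic open-string vertex algebra (MOSVA) is a $\mathbb{Z}$-graded space $V=\coprod_{n\in\mathbb Z}V_{(n)}$, $V_{(n)}=0$ for $n$ sufficiently negative, with a linear map $Y_V:V\otimes V\to V[[x,x^{-1}]]$, $Y_V(u,x)v=\sum_{k\in\mathbb Z}(Y_V)_k(u)v\,x^{-k-1}$, and $\mathbf 1\in V$ such that, with $\mathbf d_Vv=nv$ for $v\in V_{(n)}$, $D_Vv=\lim_{x\to0}\frac{d}{dx}Y_V(v,x)\mathbf 1$ and $V'=\coprod V_{(n)}^*$: (i) $[\mathbf d_V,Y_V(v,x)]=x\frac{d}{dx}Y_V(v,x)+Y_V(\mathbf d_Vv,x)$; (ii) $Y_V(\mathbf 1,x)=1_V$, $Y_V(u,x)\mathbf 1\in V[[x]]$ with constant term $u$; (iii) $\frac{d}{dx}Y_V(v,x)=Y_V(D_Vv,x)=[D_V,Y_V(v,x)]$; (iv) $\langle v',Y_V(u_1,z_1)\cdots Y_V(u_n,z_n)v\rangle$ converges absolutely for $|z_1|>\cdots>|z_n|>0$ to a rational function with only possible poles $z_i=0$, $z_i=z_j$, and $\langle v',Y_V(Y_V(u_1,z_1-z_2)u_2,z_2)v\rangle$ converges absolutely for $|z_2|>|z_1-z_2|>0$ to a rational function with only possible poles $z_1=0,z_2=0,z_1=z_2$; (v) $\langle v',Y_V(u_1,z_1)Y_V(u_2,z_2)v\rangle=\langle v',Y_V(Y_V(u_1,z_1-z_2)u_2,z_2)v\rangle$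 for $|z_1|>|z_2|>|z_1-z_2|>0$. **Bimodules.** A $V$-bimodule is a $\mathbb C$-graded space $W=\coprod_{m\in\mathbb C}W_{[m]}$, $W_{[m]}=0$ for $\mathrm{Re}\,m$ sufficiently negative, with $\mathbf d_Ww=mw$ for $w\in W_{[m]}$, an operator $D_W$ of weight $1$, and linear maps $Y_W^L:V\otimes W\to W[[x,x^{-1}]]$, $Y_W^R:W\otimes V\to W[[x,x^{-1}]]$ such that, with $W'=\coprod W_{[m]}^*$: Left module axioms: $[\mathbf d_W,Y_W^L(u,x)]=Y_W^L(\mathbf d_Vu,x)+x\frac{d}{dx}Y_W^L(u,x)$; $Y_W^L(\mathbf 1,x)=1_W$; $\frac{d}{dx}Y_W^L(u,x)=Y_W^L(D_Vu,x)=[D_W,Y_W^L(u,x)]$; the analogues of (iv), (v) for $\langle w',Y^L_W(u_1,z_1)\cdots Y^L_W(u_n,z_n)w\rangle$ and $\langle w',Y_W^L(Y_V(u_1,z_1-z_2)u_2,z_2)w\rangle$. Right module axioms: $\mathbf d_WY_W^R(w,x)-Y_W^R(w,x)\mathbf d_V=Y_W^R(\mathbf d_Ww,x)+x\frac{d}{dx}Y_W^R(w,x)$; $Y_W^R(w,x)\mathbf 1\in W[[x]]$ with constant term $w$; $\frac{d}{dx}Y_W^R(w,x)=Y_W^R(D_Ww,x)=D_WY_W^R(w,x)-Y_W^R(w,x)D_V$; the analogues of (iv), (v) for $\langle w',Y_W^R(w,z_1)Y_V(u_1,z_2)\cdots Y_V(u_{n-1},z_n)u_n\rangle$ and $\langle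 w',Y_W^R(Y_W^R(w,z_1-z_2)u_1,z_2)u_2\rangle$. Compatibility: $\langle w',Y_W^L(u_1,z_1)\cdots Y_W^L(u_n,z_n)Y_W^R(w,z_{n+1})Y_V(u_{n+1},z_{n+2})\cdots Y_V(u_{n+m-1},z_{n+m})u_{n+m}\rangle$ converges absolutely for $|z_1|>\cdots>|z_{n+m}|>0$ to a rational function; and $\langle w',Y_W^L(u,z_1)Y_W^R(w,z_2)v\rangle$ (for $|z_1|>|z_2|>0$) and $\langle w',Y_W^R(Y_W^L(u,z_1-z_2)w,z_2)v\rangle$ (for $|z_2|>|z_1-z_2|>0$) converge absolutely to a common rational function with only possible poles $z_1=0,z_2=0,z_1=z_2$. Write $Y_W^L(v,x)=\sum_k(Y_W^L)_k(v)x^{-k-1}$. **Pole-order condition.** $V$ satisfies it if for all $u_1,v\in V$ there is $C$ such that for all $v'\in V',u_2\in V$ the pole $z_1=0$ of the rational function of $\langle v',Y_V(u_1,z_1)Y_V(u_2,z_2)v\rangle$ has order $<C$. $W$ satisfies it if the order of the pole $z_1=0$ is bounded for the rational functions of: $\langle w',Y_W^L(u_1,z_1)Y_W^L(u_2,z_2)w\rangle$ (bound depending only on $u_1,w$); $\langle w',Y_W^R(w,z_1)Y_V(u_1,z_2)u_2\rangle$ (only on $u_2,w$); $\langle w',Y_W^L(u_1,z_1)Y_W^R(w,z_2)u_2\rangle$ (only on $u_1,u_2$). **$\overline W$-valued rational functions.** $\overline W=\prod_mW_{[m]}$, paired with $W'$; finite sums of homogeneous operators on $W$ (such as $(Y_W^L)_k(v)$)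 act on $\overline W$ componentwise. $F_n\mathbb C=\{(z_1,\dots,z_n)\in\mathbb C^n:z_i\ne z_j\ (i\neq j)\}$. $\widetilde W_{z_1,\dots,z_n}$ is the space of $\overline W$-valued rational functions, i.e. maps $f:F_n\mathbb C\to\overline W$ such that (1) for each $w'\in W'$, $\langle w',f(z_1,\dots,z_n)\rangle$ is a rational function with only possible poles $z_i=z_j$; (2) there are integers $p_{ij}$ and $g\in W[[x_1,\dots,x_n]]$ with $\prod_{i<j}(z_i-z_j)^{p_{ij}}\langle w',f(z_1,\dots,z_n)\rangle=\langle w',g(z_1,\dots,z_n)\rangle$ as polynomial functions, for all $w'$. **Series.** $Y_W^L(v_1,z_1)Y_W^L(v_2,z_2)f(\cdots)$ denotes the double series $\sum_{k_1,k_2}(Y_W^L)_{k_1}(v_1)(Y_W^L)_{k_2}(v_2)f(\cdots)z_1^{-k_1-1}z_2^{-k_2-1}$ of elements of $\overline W$, and $Y_W^L(Y_V(v_1,z_1-z_2)v_2,z_2)f(\cdots)$ denotes $\sum_{k_1,k_2}(Y_W^L)_{k_2}((Y_V)_{k_1}(v_1)v_2)f(\cdots)(z_1-z_2)^{-k_1-1}z_2^{-k_2-1}$. Such a series converges absolutely if it does so after pairing with every $w'\in W'$. *)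

theory Defs
  imports "HOL-Analysis.Analysis"
begin

section \<open>Graded complex vector spaces, graded duals and completions\<close>

definition decomposition :: "('i \<Rightarrow> 'b::ab_group_add set) \<Rightarrow> 'b \<Rightarrow> ('i \<Rightarrow> 'b) \<Rightarrow> bool" where
  "decomposition G w c \<longleftrightarrow>
     finite {m. c m \<noteq> 0} \<and> (\<forall>m. c m \<in> G m) \<and> w = (\<Sum>m | c m \<noteq> 0. c m)"

locale graded_space = vector_space scale
  for scale :: "complex \<Rightarrow> 'b::ab_group_add \<Rightarrow> 'b" +
  fixes G :: "'i \<Rightarrow> 'b set"
  assumes subspace_G: "module.subspace scale (G m)"
    and direct_sum: "\<exists>!c. decomposition G w c"

definition component :: "('i \<Rightarrow> 'b::ab_group_add set) \<Rightarrow> 'b \<Rightarrow> 'i \<Rightarrow> 'b" where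
  "component G w = (THE c. decomposition G w c)"

text \<open>The operator multiplying the homogeneous space of index \<open>m\<close> by \<open>wt m\<close>.\<close>

definition grading_op ::
  "(complex \<Rightarrow> 'b \<Rightarrow> 'b) \<Rightarrow> ('i \<Rightarrow> complex) \<Rightarrow> ('i \<Rightarrow> 'b::ab_group_add set) \<Rightarrow> 'b \<Rightarrow> 'b" where
  "grading_op s wt G w =
     (\<Sum>m | component G w m \<noteq> 0. s (wt m) (component G w m))"

text \<open>The direct sum of the full dual spaces of the homogeneous subspaces: linear functionals on the
  whole space that vanish on all but finitely many homogeneous subspaces.\<close>

definition graded_dual ::
  "(complex \<Rightarrow> 'b \<Rightarrow> 'b) \<Rightarrow> ('i \<Rightarrow> 'b::ab_group_add set) \<Rightarrow> ('b \<Rightarrow> complex) set" where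
  "graded_dual s G =
     {\<phi>. Vector_Spaces.linear s (*) \<phi> \<and> finite {m. \<exists>w\<in>G m. \<phi> w \<noteq> 0}}"

definition completion :: "('i \<Rightarrow> 'b set) \<Rightarrow> ('i \<Rightarrow> 'b) set" where
  "completion G = {f. \<forall>m. f m \<in> G m}"

text \<open>The sum is finite for \<open>\<phi>\<close> in the graded dual and \<open>f\<close> in the completion.\<close>

definition pair :: "('b \<Rightarrow> complex) \<Rightarrow> ('i \<Rightarrow> 'b::ab_group_add) \<Rightarrow> complex" where
  "pair \<phi> f = (\<Sum>m | \<phi> (f m) \<noteq> 0. \<phi> (f m))"

text \<open>Action on the completion of an operator \<open>A\<close> that is a finite sum of homogeneous operators: for
  such an \<open>A\<close>, only finitely many components \<open>f l\<close> contribute to the component of index \<open>m\<close>.\<close>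

definition extend_op ::
  "('i \<Rightarrow> 'b::ab_group_add set) \<Rightarrow> ('b \<Rightarrow> 'b) \<Rightarrow> ('i \<Rightarrow> 'b) \<Rightarrow> ('i \<Rightarrow> 'b)" where
  "extend_op G A f =
     (\<lambda>m. \<Sum>l | component G (A (f l)) m \<noteq> 0. component G (A (f l)) m)"


section \<open>Rational functions in several variables\<close>

text \<open>Points of \<open>n\<close>-dimensional complex space are lists of length \<open>n\<close>.\<close>

definition config :: "nat \<Rightarrow> complex list set" where
  "config n = {zs. length zs = n \<and> distinct zs}"

definition mon :: "complex list \<Rightarrow> nat list \<Rightarrow> complex" where
  "mon zs \<alpha> = (\<Prod>i<length zs. (zs ! i) ^ (\<alpha> ! i))"

definition polyfun :: "nat \<Rightarrow> (complex list \<Rightarrow> complex) \<Rightarrow> bool" where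
  "polyfun n p \<longleftrightarrow>
     (\<exists>A c. finite A \<and> A \<subseteq> {\<alpha>. length \<alpha> = n} \<and>
        (\<forall>zs. length zs = n \<longrightarrow> p zs = (\<Sum>\<alpha>\<in>A. c \<alpha> * mon zs \<alpha>)))"

definition pole_denom :: "(nat \<Rightarrow> nat) \<Rightarrow> (nat \<Rightarrow> nat \<Rightarrow> nat) \<Rightarrow> complex list \<Rightarrow> complex" where
  "pole_denom a b zs =
     (\<Prod>i<length zs. (zs ! i) ^ a i) *
     (\<Prod>j<length zs. \<Prod>i<j. (zs ! i - zs ! j) ^ b i j)"

text \<open>Rational functions whose only possible poles are \<open>z\<^sub>i = 0\<close>, of order at most \<open>a i\<close>, and
  \<open>z\<^sub>i = z\<^sub>j\<close>. Only the values off these hyperplanes matter.\<close>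

definition rational_poles_le :: "nat \<Rightarrow> (nat \<Rightarrow> nat) \<Rightarrow> (complex list \<Rightarrow> complex) \<Rightarrow> bool" where
  "rational_poles_le n a R \<longleftrightarrow>
     (\<exists>p b. polyfun n p \<and>
        (\<forall>zs\<in>config n. 0 \<notin> set zs \<longrightarrow> R zs = p zs / pole_denom a b zs))"

definition rational_poles :: "nat \<Rightarrow> (complex list \<Rightarrow> complex) \<Rightarrow> bool" where
  "rational_poles n R \<longleftrightarrow> (\<exists>a. rational_poles_le n a R)"

text \<open>Order of the pole \<open>z\<^sub>1 = 0\<close> (index \<open>0\<close> in the list); it is \<open>0\<close> if there is no pole.\<close>

definition pole_order_z1 :: "nat \<Rightarrow> (complex list \<Rightarrow> complex) \<Rightarrow> nat" where
  "pole_order_z1 n R = (LEAST N. \<exists>a. a 0 = N \<and> rational_poles_le n a R)"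

text \<open>Rational functions whose only possible poles are \<open>z\<^sub>i = z\<^sub>j\<close>.\<close>

definition rational_diag_poles :: "nat \<Rightarrow> (complex list \<Rightarrow> complex) \<Rightarrow> bool" where
  "rational_diag_poles n R \<longleftrightarrow>
     (\<exists>p b. polyfun n p \<and> (\<forall>zs\<in>config n. R zs = p zs / pole_denom (\<lambda>_. 0) b zs))"


section \<open>Laurent series and products of vertex operators\<close>

text \<open>\<open>T [k\<^sub>1, \<dots>, k\<^sub>n]\<close> is the coefficient of \<open>z\<^sub>1\<close> to the \<open>-k\<^sub>1-1\<close> times \<open>\<dots>\<close> times \<open>z\<^sub>n\<close> to the \<open>-k\<^sub>n-1\<close>.\<close>

definition laurent_term :: "(int list \<Rightarrow> complex) \<Rightarrow> complex list \<Rightarrow> int list \<Rightarrow> complex" where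
  "laurent_term T zs ks = T ks * (\<Prod>i<length zs. (zs ! i) powi (- (ks ! i) - 1))"

definition abs_converges_to :: "(int list \<Rightarrow> complex) \<Rightarrow> complex list \<Rightarrow> complex \<Rightarrow> bool" where
  "abs_converges_to T zs s \<longleftrightarrow>
     (\<lambda>ks. norm (laurent_term T zs ks)) summable_on {ks. length ks = length zs} \<and>
     (laurent_term T zs has_sum s) {ks. length ks = length zs}"

definition product_region :: "nat \<Rightarrow> complex list set" where
  "product_region n =
     {zs. length zs = n \<and> sorted_wrt (\<lambda>x y. cmod x > cmod y) zs \<and> 0 \<notin> set zs}"

definition product_converges_to ::
  "nat \<Rightarrow> (int list \<Rightarrow> complex) \<Rightarrow> (complex list \<Rightarrow> complex) \<Rightarrow> bool" where
  "product_converges_to n T R \<longleftrightarrow> (\<forall>zs\<in>product_region n. abs_converges_to T zs (R zs))"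

text \<open>Here \<open>T [k\<^sub>1, k\<^sub>2]\<close> is the coefficient in a series in \<open>z\<^sub>1 - z\<^sub>2\<close> and \<open>z\<^sub>2\<close>, while \<open>R\<close> is a function of
  \<open>z\<^sub>1\<close> and \<open>z\<^sub>2\<close>.\<close>

definition iterate_converges_to ::
  "(int list \<Rightarrow> complex) \<Rightarrow> (complex list \<Rightarrow> complex) \<Rightarrow> bool" where
  "iterate_converges_to T R \<longleftrightarrow>
     (\<forall>z1 z2. cmod z2 > cmod (z1 - z2) \<and> cmod (z1 - z2) > 0 \<longrightarrow>
        abs_converges_to T [z1 - z2, z2] (R [z1, z2]))"

text \<open>Associativity: the product series \<open>T\<close> and the iterate series \<open>S\<close> have the same sum on the
  common region.\<close>

definition agree_on_overlap :: "(int list \<Rightarrow> complex) \<Rightarrow> (int list \<Rightarrow> complex) \<Rightarrow> bool" where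
  "agree_on_overlap T S \<longleftrightarrow>
     (\<forall>z1 z2. cmod z1 > cmod z2 \<and> cmod z2 > cmod (z1 - z2) \<and> cmod (z1 - z2) > 0 \<longrightarrow>
        (\<exists>s. abs_converges_to T [z1, z2] s \<and> abs_converges_to S [z1 - z2, z2] s))"

text \<open>The product of the modes \<open>Y\<^sub>k\<^sub>1(u\<^sub>1) \<dots> Y\<^sub>k\<^sub>n(u\<^sub>n)\<close> applied to \<open>w\<close>.\<close>

definition modes :: "(int \<Rightarrow> 'v \<Rightarrow> 'w \<Rightarrow> 'w) \<Rightarrow> 'v list \<Rightarrow> int list \<Rightarrow> 'w \<Rightarrow> 'w" where
  "modes Y us ks w = foldr (\<lambda>(k, u). Y k u) (zip ks us) w"


section \<open>Meromorphic open-string vertex algebras\<close>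

text \<open>A map \<open>Y\<^sub>V\<close> into formal series is given by its modes: \<open>Y k u v\<close> is the coefficient of \<open>x\<close> to the
  \<open>-k-1\<close> in \<open>Y\<^sub>V(u,x)v\<close>. The axioms on formal series are stated on coefficients. In particular
  \<open>D\<^sub>V v\<close>, the value at \<open>x = 0\<close> of the derivative of \<open>Y\<^sub>V(v,x)1\<close>, is the coefficient of \<open>x\<close> in
  \<open>Y\<^sub>V(v,x)1\<close>, and the coefficient of \<open>x\<close> to the \<open>-k-1\<close> in the derivative of \<open>Y\<^sub>V(v,x)\<close> is
  \<open>-k Y\<^sub>k\<^sub>-\<^sub>1(v)\<close>.\<close>

definition mosva_D :: "(int \<Rightarrow> 'v \<Rightarrow> 'v \<Rightarrow> 'v) \<Rightarrow> 'v \<Rightarrow> 'v \<Rightarrow> 'v" where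
  "mosva_D Y vac v = Y (-2) v vac"

abbreviation mosva_d ::
  "(complex \<Rightarrow> 'v \<Rightarrow> 'v) \<Rightarrow> (int \<Rightarrow> 'v::ab_group_add set) \<Rightarrow> 'v \<Rightarrow> 'v" where
  "mosva_d s \<equiv> grading_op s of_int"

locale mosva = graded_space sV V
  for sV :: "complex \<Rightarrow> 'v::ab_group_add \<Rightarrow> 'v" and V :: "int \<Rightarrow> 'v set" +
  fixes Y :: "int \<Rightarrow> 'v \<Rightarrow> 'v \<Rightarrow> 'v" and vac :: 'v
  assumes lower_truncated: "\<exists>N. \<forall>n<N. V n = {0}"
    and Y_linear_right: "Vector_Spaces.linear sV sV (Y k u)"
    and Y_linear_left: "Vector_Spaces.linear sV sV (\<lambda>u. Y k u v)"
    and d_commutator: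
      "mosva_d sV V (Y k u v) - Y k u (mosva_d sV V v) =
         sV (of_int (- k - 1)) (Y k u v) + Y k (mosva_d sV V u) v"
    and identity: "Y k vac v = (if k = -1 then v else 0)"
    and creation: "k \<ge> 0 \<Longrightarrow> Y k u vac = 0" "Y (-1) u vac = u"
    and D_derivative: "Y k (mosva_D Y vac u) v = sV (of_int (- k)) (Y (k - 1) u v)"
    and D_commutator:
      "mosva_D Y vac (Y k u v) - Y k u (mosva_D Y vac v) = sV (of_int (- k)) (Y (k - 1) u v)"
    and rationality_product:
      "\<phi> \<in> graded_dual sV V \<Longrightarrow>
         \<exists>R. rational_poles (length us) R \<and>
             product_converges_to (length us) (\<lambda>ks. \<phi> (modes Y us ks v)) R"
    and rationality_iterate:
      "\<phi> \<in> graded_dual sV V \<Longrightarrow>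
         \<exists>R. rational_poles 2 R \<and>
             iterate_converges_to (\<lambda>ks. \<phi> (Y (ks ! 1) (Y (ks ! 0) u1 u2) v)) R"
    and associativity:
      "\<phi> \<in> graded_dual sV V \<Longrightarrow>
         agree_on_overlap (\<lambda>ks. \<phi> (modes Y [u1, u2] ks v))
           (\<lambda>ks. \<phi> (Y (ks ! 1) (Y (ks ! 0) u1 u2) v))"


section \<open>Bimodules\<close>

abbreviation module_d ::
  "(complex \<Rightarrow> 'w \<Rightarrow> 'w) \<Rightarrow> (complex \<Rightarrow> 'w::ab_group_add set) \<Rightarrow> 'w \<Rightarrow> 'w" where
  "module_d s \<equiv> grading_op s (\<lambda>m. m)"

locale mosva_bimodule = mosva sV V Y vac + W: graded_space sW W
  for sV :: "complex \<Rightarrow> 'v::ab_group_add \<Rightarrow> 'v" and V :: "int \<Rightarrow> 'v set"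
    and Y :: "int \<Rightarrow> 'v \<Rightarrow> 'v \<Rightarrow> 'v" and vac :: 'v
    and sW :: "complex \<Rightarrow> 'w::ab_group_add \<Rightarrow> 'w" and W :: "complex \<Rightarrow> 'w set" +
  fixes DW :: "'w \<Rightarrow> 'w"
    and YL :: "int \<Rightarrow> 'v \<Rightarrow> 'w \<Rightarrow> 'w"
    and YR :: "int \<Rightarrow> 'w \<Rightarrow> 'v \<Rightarrow> 'w"
  assumes W_lower_truncated: "\<exists>N. \<forall>m. Re m < N \<longrightarrow> W m = {0}"
    and DW_linear: "Vector_Spaces.linear sW sW DW"
    and DW_weight: "w \<in> W m \<Longrightarrow> DW w \<in> W (m + 1)"
    and YL_linear_right: "Vector_Spaces.linear sW sW (YL k u)"
    and YL_linear_left: "Vector_Spaces.linear sV sW (\<lambda>u. YL k u w)"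
    and YR_linear_right: "Vector_Spaces.linear sV sW (YR k w)"
    and YR_linear_left: "Vector_Spaces.linear sW sW (\<lambda>w. YR k w v)"
    \<comment> \<open>left module axioms\<close>
    and L_d_commutator:
      "module_d sW W (YL k u w) - YL k u (module_d sW W w) =
         YL k (mosva_d sV V u) w + sW (of_int (- k - 1)) (YL k u w)"
    and L_identity: "YL k vac w = (if k = -1 then w else 0)"
    and L_D_derivative: "YL k (mosva_D Y vac u) w = sW (of_int (- k)) (YL (k - 1) u w)"
    and L_D_commutator: "DW (YL k u w) - YL k u (DW w) = sW (of_int (- k)) (YL (k - 1) u w)"
    and L_rationality_product:
      "\<phi> \<in> graded_dual sW W \<Longrightarrow>
         \<exists>R. rational_poles (length us) R \<and>
             product_converges_to (length us) (\<lambda>ks. \<phi> (modes YL us ks w)) R"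
    and L_rationality_iterate:
      "\<phi> \<in> graded_dual sW W \<Longrightarrow>
         \<exists>R. rational_poles 2 R \<and>
             iterate_converges_to (\<lambda>ks. \<phi> (YL (ks ! 1) (Y (ks ! 0) u1 u2) w)) R"
    and L_associativity:
      "\<phi> \<in> graded_dual sW W \<Longrightarrow>
         agree_on_overlap (\<lambda>ks. \<phi> (modes YL [u1, u2] ks w))
           (\<lambda>ks. \<phi> (YL (ks ! 1) (Y (ks ! 0) u1 u2) w))"
    \<comment> \<open>right module axioms\<close>
    and R_d_commutator:
      "module_d sW W (YR k w v) - YR k w (mosva_d sV V v) =
         YR k (module_d sW W w) v + sW (of_int (- k - 1)) (YR k w v)"
    and R_creation: "k \<ge> 0 \<Longrightarrow> YR k w vac = 0" "YR (-1) w vac = w"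
    and R_D_derivative: "YR k (DW w) v = sW (of_int (- k)) (YR (k - 1) w v)"
    and R_D_commutator:
      "DW (YR k w v) - YR k w (mosva_D Y vac v) = sW (of_int (- k)) (YR (k - 1) w v)"
    and R_rationality_product:
      "\<phi> \<in> graded_dual sW W \<Longrightarrow>
         \<exists>R. rational_poles (Suc (length us)) R \<and>
             product_converges_to (Suc (length us))
               (\<lambda>ks. \<phi> (YR (hd ks) w (modes Y us (tl ks) v))) R"
    and R_rationality_iterate:
      "\<phi> \<in> graded_dual sW W \<Longrightarrow>
         \<exists>R. rational_poles 2 R \<and>
             iterate_converges_to (\<lambda>ks. \<phi> (YR (ks ! 1) (YR (ks ! 0) w u1) u2)) R"
    and R_associativity:
      "\<phi> \<in> graded_dual sW W \<Longrightarrow>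
         agree_on_overlap (\<lambda>ks. \<phi> (YR (ks ! 0) w (Y (ks ! 1) u1 u2)))
           (\<lambda>ks. \<phi> (YR (ks ! 1) (YR (ks ! 0) w u1) u2))"
    \<comment> \<open>Compatibility. In the first axiom the limit is an arbitrary quotient \<open>p/q\<close> of polynomials,
        without a prescribed pole set.\<close>
    and LR_rationality_product:
      "\<phi> \<in> graded_dual sW W \<Longrightarrow>
         \<exists>p q. polyfun (length us + Suc (length vs)) p \<and>
               polyfun (length us + Suc (length vs)) q \<and>
               (\<forall>zs\<in>product_region (length us + Suc (length vs)). q zs \<noteq> 0) \<and>
               product_converges_to (length us + Suc (length vs))
                 (\<lambda>ks. \<phi> (modes YL us (take (length us) ks)
                           (YR (ks ! length us) w
                              (modes Y vs (drop (Suc (length us)) ks) v))))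
                 (\<lambda>zs. p zs / q zs)"
    and LR_associativity:
      "\<phi> \<in> graded_dual sW W \<Longrightarrow>
         \<exists>R. rational_poles 2 R \<and>
             product_converges_to 2 (\<lambda>ks. \<phi> (YL (ks ! 0) u (YR (ks ! 1) w v))) R \<and>
             iterate_converges_to (\<lambda>ks. \<phi> (YR (ks ! 1) (YL (ks ! 0) u w) v)) R"


section \<open>The pole-order condition\<close>

text \<open>\<open>T\<close> is the coefficient family of a product series in two variables; the condition says that the
  rational function it converges to (which is unique) has a pole of order less than \<open>C\<close> at \<open>z\<^sub>1 = 0\<close>.\<close>

definition z1_pole_less :: "nat \<Rightarrow> (int list \<Rightarrow> complex) \<Rightarrow> bool" where
  "z1_pole_less C T \<longleftrightarrow>
     (\<forall>R. rational_poles 2 R \<and> product_converges_to 2 T R \<longrightarrow> pole_order_z1 2 R < C)"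

definition mosva_pole_order_condition ::
  "(complex \<Rightarrow> 'v \<Rightarrow> 'v) \<Rightarrow> (int \<Rightarrow> 'v::ab_group_add set) \<Rightarrow> (int \<Rightarrow> 'v \<Rightarrow> 'v \<Rightarrow> 'v) \<Rightarrow> bool" where
  "mosva_pole_order_condition sV V Y \<longleftrightarrow>
     (\<forall>u1 v. \<exists>C. \<forall>\<phi>\<in>graded_dual sV V. \<forall>u2.
        z1_pole_less C (\<lambda>ks. \<phi> (Y (ks ! 0) u1 (Y (ks ! 1) u2 v))))"

definition bimodule_pole_order_condition ::
  "(int \<Rightarrow> 'v \<Rightarrow> 'v \<Rightarrow> 'v) \<Rightarrow> (complex \<Rightarrow> 'w \<Rightarrow> 'w) \<Rightarrow> (complex \<Rightarrow> 'w::ab_group_add set) \<Rightarrow>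
   (int \<Rightarrow> 'v \<Rightarrow> 'w \<Rightarrow> 'w) \<Rightarrow> (int \<Rightarrow> 'w \<Rightarrow> 'v \<Rightarrow> 'w) \<Rightarrow> bool" where
  "bimodule_pole_order_condition Y sW W YL YR \<longleftrightarrow>
     (\<forall>u1 w. \<exists>C. \<forall>\<phi>\<in>graded_dual sW W. \<forall>u2.
        z1_pole_less C (\<lambda>ks. \<phi> (YL (ks ! 0) u1 (YL (ks ! 1) u2 w)))) \<and>
     (\<forall>u2 w. \<exists>C. \<forall>\<phi>\<in>graded_dual sW W. \<forall>u1.
        z1_pole_less C (\<lambda>ks. \<phi> (YR (ks ! 0) w (Y (ks ! 1) u1 u2)))) \<and>
     (\<forall>u1 u2. \<exists>C. \<forall>\<phi>\<in>graded_dual sW W. \<forall>w.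
        z1_pole_less C (\<lambda>ks. \<phi> (YL (ks ! 0) u1 (YR (ks ! 1) w u2))))"


section \<open>Rational functions with values in the completion\<close>

text \<open>The power series \<open>g\<close> is given by its coefficients in the space itself; its pairing with each
  \<open>\<phi>\<close> in the graded dual has to be a polynomial, i.e. to have finite support.\<close>

definition rational_maps ::
  "(complex \<Rightarrow> 'w \<Rightarrow> 'w) \<Rightarrow> (complex \<Rightarrow> 'w::ab_group_add set) \<Rightarrow> nat \<Rightarrow>
   (complex list \<Rightarrow> complex \<Rightarrow> 'w) set" where
  "rational_maps sW W n =
     {f. (\<forall>zs\<in>config n. f zs \<in> completion W) \<and>
         (\<forall>\<phi>\<in>graded_dual sW W. rational_diag_poles n (\<lambda>zs. pair \<phi> (f zs))) \<and>
         (\<exists>(p :: nat \<Rightarrow> nat \<Rightarrow> int) (g :: nat list \<Rightarrow> 'w). \<forall>\<phi>\<in>graded_dual sW W.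
            finite {\<alpha>. length \<alpha> = n \<and> \<phi> (g \<alpha>) \<noteq> 0} \<and>
            (\<forall>zs\<in>config n.
               (\<Prod>j<n. \<Prod>i<j. (zs ! i - zs ! j) powi p i j) * pair \<phi> (f zs) =
               (\<Sum>\<alpha> | length \<alpha> = n \<and> \<phi> (g \<alpha>) \<noteq> 0. \<phi> (g \<alpha>) * mon zs \<alpha>)))}"

text \<open>Absolute convergence, after pairing with every \<open>\<phi>\<close> in the graded dual, of a series with
  coefficients in the completion.\<close>

definition completion_converges_to ::
  "(complex \<Rightarrow> 'w \<Rightarrow> 'w) \<Rightarrow> (complex \<Rightarrow> 'w::ab_group_add set) \<Rightarrow>
   (int list \<Rightarrow> complex \<Rightarrow> 'w) \<Rightarrow> complex list \<Rightarrow> (complex \<Rightarrow> 'w) \<Rightarrow> bool" where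
  "completion_converges_to sW W T zs s \<longleftrightarrow>
     (\<forall>\<phi>\<in>graded_dual sW W. abs_converges_to (\<lambda>ks. pair \<phi> (T ks)) zs (pair \<phi> s))"

end

theory Submission
  imports Defs
begin

text \<open>Fix \<open>\<phi>\<close> and \<open>z\<^sub>3, \<dots>\<close>. Collect the terms of the product series with \<open>k\<^sub>1 + k\<^sub>2 = K\<close>. By the grading,
  only finitely many homogeneous components of \<open>v\<^sub>1\<close>, \<open>v\<^sub>2\<close> and \<open>f\<close> contribute to them, and the same components
  contribute to the part \<open>k\<^sub>1 + k\<^sub>2 = K\<close> of the iterate series. Hence associativity for elements of \<open>W\<close> shows
  that, for each \<open>K\<close>, both parts have the same sum. On the other hand, the rational limit has an absolutely
  convergent expansion in \<open>z\<^sub>1 - z\<^sub>2\<close> and \<open>z\<^sub>2\<close> on the whole region \<open>|z\<^sub>2| > |z\<^sub>1 - z\<^sub>2| + |z\<^sub>i|\<close>, because its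
  poles there are \<open>z\<^sub>1 = z\<^sub>2\<close>, \<open>z\<^sub>2 = z\<^sub>i\<close> and \<open>z\<^sub>1 = z\<^sub>i\<close>. Comparing Laurent coefficients first in the
  total degree, then in \<open>(z\<^sub>1 - z\<^sub>2)/z\<^sub>2\<close>, identifies this expansion with the iterate series.\<close>

section \<open>Double power series\<close>

lemma has_sum_times_complex:
  fixes f :: "'a \<Rightarrow> complex" and g :: "'b \<Rightarrow> complex"
  assumes f: "(f has_sum a) A" and g: "(g has_sum b) B"
  shows "((\<lambda>(x, y). f x * g y) has_sum (a * b)) (A \<times> B)"
proof (rule has_sum_SigmaI)
  show "((\<lambda>y. case (x, y) of (x, y) \<Rightarrow> f x * g y) has_sum (f x * b)) B" for x
    using has_sum_cmult_right[OF g, of "f x"] by simp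
  show "((\<lambda>x. f x * b) has_sum a * b) A"
    by (rule has_sum_cmult_left[OF f])
  have fa: "(\<lambda>x. norm (f x)) summable_on A" and ga: "(\<lambda>y. norm (g y)) summable_on B"
    using f g has_sum_imp_summable summable_on_iff_abs_summable_on_complex by blast+
  have "(\<lambda>p. norm (case p of (x, y) \<Rightarrow> f x * g y)) summable_on A \<times> B"
    unfolding Infinite_Sum.abs_summable_on_Sigma_iff
    using fa ga
    by (auto simp: norm_mult infsum_cmult_right' abs_mult
        intro!: summable_on_cmult_right summable_on_cmult_left infsum_nonneg)
  then show "(\<lambda>(x, y). f x * g y) summable_on A \<times> B"
    by (rule abs_summable_summable)
qed

text \<open>Regrouping an unconditionally convergent sum along \<open>h\<close>; finite fibres turn
  the inner sums into ordinary ones.\<close>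

lemma has_sum_fibers:
  fixes f :: "'a \<Rightarrow> complex"
  assumes f: "(f has_sum S) UNIV" and fin: "\<And>k. finite {x. h x = k}"
  shows "((\<lambda>k. \<Sum>x | h x = k. f x) has_sum S) UNIV"
proof (rule has_sum_SigmaD[where B = "\<lambda>k. {x. h x = k}" and f = "\<lambda>(k, x). f x"])
  show "((\<lambda>(k, x). f x) has_sum S) (SIGMA k:UNIV. {x. h x = k})"
    using f
    by (rule has_sum_reindex_bij_witness[where i = "\<lambda>x. (h x, x)" and j = snd, THEN iffD2, rotated -1])
       auto
  show "((\<lambda>x. case (k, x) of (k, x) \<Rightarrow> f x) has_sum (\<Sum>x | h x = k. f x)) {x. h x = k}" for k
    using fin[of k] by (simp add: has_sum_finite)
qed

text \<open>The variables are \<open>s = (z\<^sub>1 - z\<^sub>2)/z\<^sub>2\<close> and \<open>t = 1/z\<^sub>2\<close>, and \<open>r\<close> bounds the remaining \<open>|z\<^sub>i|\<close>, so that the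
  condition on \<open>s\<close> and \<open>t\<close> describes the region \<open>|z\<^sub>2| > |z\<^sub>1 - z\<^sub>2| + r\<close>.\<close>

definition pser_coeffs :: "real \<Rightarrow> (nat \<times> nat \<Rightarrow> complex) \<Rightarrow> (complex \<Rightarrow> complex \<Rightarrow> complex) \<Rightarrow> bool" where
  "pser_coeffs r C G \<longleftrightarrow> (\<forall>s t. s \<noteq> 0 \<longrightarrow> t \<noteq> 0 \<longrightarrow> cmod s + r * cmod t < 1 \<longrightarrow>
     ((\<lambda>k. C k * (s ^ fst k * t ^ snd k)) has_sum G s t) UNIV)"

definition pser :: "real \<Rightarrow> (complex \<Rightarrow> complex \<Rightarrow> complex) \<Rightarrow> bool" where
  "pser r G \<longleftrightarrow> (\<exists>C. pser_coeffs r C G)"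

lemma pser_coeffsI:
  assumes "\<And>s t. s \<noteq> 0 \<Longrightarrow> t \<noteq> 0 \<Longrightarrow> cmod s + r * cmod t < 1 \<Longrightarrow>
     ((\<lambda>k. C k * (s ^ fst k * t ^ snd k)) has_sum G s t) UNIV"
  shows "pser_coeffs r C G"
  using assms unfolding pser_coeffs_def by blast

lemma pser_coeffsD:
  assumes "pser_coeffs r C G" "s \<noteq> 0" "t \<noteq> 0" "cmod s + r * cmod t < 1"
  shows "((\<lambda>k. C k * (s ^ fst k * t ^ snd k)) has_sum G s t) UNIV"
  using assms unfolding pser_coeffs_def by blast

text \<open>Points with \<open>s = 0\<close> or \<open>t = 0\<close> impose nothing, so formulas
  dividing by \<open>s\<close> or \<open>t\<close> can be simplified.\<close>

lemma pser_cong: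
  assumes "pser r G" "\<And>s t. s \<noteq> 0 \<Longrightarrow> t \<noteq> 0 \<Longrightarrow> cmod s + r * cmod t < 1 \<Longrightarrow> G s t = G' s t"
  shows "pser r G'"
proof -
  obtain C where C: "pser_coeffs r C G" using assms(1) unfolding pser_def by blast
  have "pser_coeffs r C G'"
    using pser_coeffsD[OF C] assms(2) by (intro pser_coeffsI) simp
  then show ?thesis unfolding pser_def by blast
qed

lemma pser_monom: "pser r (\<lambda>s t. c * (s ^ a * t ^ b))"
  unfolding pser_def
proof (intro exI pser_coeffsI)
  fix s t
  show "((\<lambda>k. (if k = (a, b) then c else 0) * (s ^ fst k * t ^ snd k)) has_sum c * (s ^ a * t ^ b)) UNIV"
    by (rule has_sum_finite_neutralI[where B = "{(a, b)}"]) auto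
qed

lemma pser_add:
  assumes "pser r G" "pser r H"
  shows "pser r (\<lambda>s t. G s t + H s t)"
proof -
  obtain C D where C: "pser_coeffs r C G" and D: "pser_coeffs r D H"
    using assms unfolding pser_def by blast
  have "pser_coeffs r (\<lambda>k. C k + D k) (\<lambda>s t. G s t + H s t)"
    using has_sum_add[OF pser_coeffsD[OF C] pser_coeffsD[OF D]]
    by (intro pser_coeffsI) (simp add: algebra_simps)
  then show ?thesis unfolding pser_def by blast
qed

text \<open>Cauchy product: the product of both series is regrouped along \<open>add\<close>, the
  addition of exponent pairs, whose fibres are finite.\<close>

lemma pser_mult:
  assumes "pser r G" "pser r H"
  shows "pser r (\<lambda>s t. G s t * H s t)"
proof -
  obtain C D where C: "pser_coeffs r C G" and D: "pser_coeffs r D H"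
    using assms unfolding pser_def by blast
  define add where "add x = (fst (fst x) + fst (snd x), snd (fst x) + snd (snd x))"
    for x :: "(nat \<times> nat) \<times> (nat \<times> nat)"
  define E where "E k = (\<Sum>x | add x = k. C (fst x) * D (snd x))" for k
  have fin: "finite {x. add x = k}" for k
    by (rule finite_subset[of _ "({..fst k} \<times> {..snd k}) \<times> ({..fst k} \<times> {..snd k})"])
       (auto simp: add_def)
  have "((\<lambda>k. E k * (s ^ fst k * t ^ snd k)) has_sum G s t * H s t) UNIV"
    if st: "s \<noteq> 0" "t \<noteq> 0" "cmod s + r * cmod t < 1" for s t
  proof -
    let ?F = "\<lambda>x. C (fst x) * (s ^ fst (fst x) * t ^ snd (fst x)) * (D (snd x) * (s ^ fst (snd x) * t ^ snd (snd x)))"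
    have "(?F has_sum G s t * H s t) UNIV"
      using has_sum_times_complex[OF pser_coeffsD[OF C st] pser_coeffsD[OF D st]] by (simp add: case_prod_unfold)
    then have "((\<lambda>k. \<Sum>x | add x = k. ?F x) has_sum G s t * H s t) UNIV"
      using fin by (rule has_sum_fibers)
    moreover have "(\<Sum>x | add x = k. ?F x) = E k * (s ^ fst k * t ^ snd k)" for k
      unfolding E_def sum_distrib_right
      by (rule sum.cong) (auto simp: add_def power_add)
    ultimately show ?thesis by simp
  qed
  then have "pser_coeffs r E (\<lambda>s t. G s t * H s t)" by (rule pser_coeffsI)
  then show ?thesis unfolding pser_def by blast
qed

text \<open>Geometric series for \<open>1 / (1 - (z * t - c * s))\<close>, expanded by the binomial
  theorem. The norms are dominated by the geometric series with ratio
  \<open>cmod s + r * cmod t < 1\<close>. It is applied with \<open>c = 1\<close> and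
  \<open>c = 0\<close>, for the poles \<open>z1 = zi\<close> and \<open>z2 = zi\<close>.\<close>

lemma pser_inverse_linear:
  assumes z: "cmod z \<le> r" and c: "cmod c \<le> 1"
  shows "pser r (\<lambda>s t. 1 / (1 + c * s - z * t))"
proof -
  define C where "C k = of_nat ((fst k + snd k) choose fst k) * (- c) ^ fst k * z ^ snd k"
    for k :: "nat \<times> nat"
  have "((\<lambda>k. C k * (s ^ fst k * t ^ snd k)) has_sum 1 / (1 + c * s - z * t)) UNIV"
    if st: "cmod s + r * cmod t < 1" for s t
  proof -
    have bin: "(\<Sum>i\<le>n. of_nat (n choose i) * a ^ i * b ^ (n - i)) = (a + b) ^ n"
      for n :: nat and a b :: "'z :: comm_semiring_1"
      by (simp add: binomial_ring)
    let ?a = "- (c * s)" and ?b = "z * t"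
    \<comment> \<open>Here \<open>fst x\<close> is the power in the geometric series and
      \<open>snd x\<close> the binomial index, so \<open>C (i, n - i)\<close> matches
      \<open>F (n, i)\<close>.\<close>
    define F where "F x = of_nat (fst x choose snd x) * ?a ^ snd x * ?b ^ (fst x - snd x)"
      for x :: "nat \<times> nat"
    have le: "cmod ?a + cmod ?b < 1"
    proof -
      have "cmod ?a \<le> cmod s" using c by (simp add: norm_mult mult_left_le_one_le)
      moreover have "cmod ?b \<le> r * cmod t" using z by (simp add: norm_mult mult_right_mono)
      ultimately show ?thesis using st by linarith
    qed
    have "(\<lambda>x. norm (F x)) summable_on (SIGMA n:UNIV. {..n})"
    proof (rule summable_on_SigmaI)
      show "((\<lambda>i. norm (F (n, i))) has_sum ((cmod ?a + cmod ?b) ^ n)) {..n}" for n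
        by (rule has_sum_finiteI) (simp_all add: F_def norm_mult norm_power flip: bin)
      show "(\<lambda>n. (cmod ?a + cmod ?b) ^ n) summable_on UNIV"
        using le by (intro summable_nonneg_imp_summable_on summable_geometric) auto
    qed auto
    then have Fs: "F summable_on (SIGMA n:UNIV. {..n})"
      by (rule abs_summable_summable)
    have "(F has_sum 1 / (1 + c * s - z * t)) (SIGMA n:UNIV. {..n})"
    proof (rule has_sum_SigmaI[OF _ _ Fs])
      show "((\<lambda>i. F (n, i)) has_sum ((?a + ?b) ^ n)) {..n}" for n
        by (rule has_sum_finiteI) (simp_all only: F_def bin fst_conv snd_conv finite_atMost)
      have lt: "cmod (?a + ?b) < 1"
        using le norm_triangle_ineq[of ?a ?b] by linarith
      have "summable (\<lambda>n. norm ((?a + ?b) ^ n))"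
        using lt by (simp add: norm_power)
      moreover have "(\<lambda>n. (?a + ?b) ^ n) sums (1 / (1 - (?a + ?b)))"
        using lt by (rule geometric_sums)
      ultimately show "((\<lambda>n. (?a + ?b) ^ n) has_sum 1 / (1 + c * s - z * t)) UNIV"
        using norm_summable_imp_has_sum by (simp add: algebra_simps)
    qed
    moreover have "C (i, n - i) * (s ^ fst (i, n - i) * t ^ snd (i, n - i)) = F (n, i)"
      if "i \<le> n" for n i
    proof -
      have "?a ^ i = (- c) ^ i * s ^ i"
        by (metis mult_minus_left power_mult_distrib)
      with that show ?thesis by (simp only: C_def F_def fst_conv snd_conv power_mult_distrib) simp
    qed
    ultimately show ?thesis
      by (subst (asm) has_sum_reindex_bij_witness[where i = "\<lambda>k. (fst k + snd k, fst k)" and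
            j = "\<lambda>x. (snd x, fst x - snd x)" and T = UNIV and
            h = "\<lambda>k. C k * (s ^ fst k * t ^ snd k)", OF _ _ _ _ _ refl]) auto
  qed
  then have "pser_coeffs r C (\<lambda>s t. 1 / (1 + c * s - z * t))" by (intro pser_coeffsI)
  then show ?thesis unfolding pser_def by blast
qed

text \<open>A monomial factor absorbs finitely many negative powers, so poles at
  \<open>s = 0\<close> and \<open>t = 0\<close> are allowed and the class is closed under sums and
  products.\<close>

definition lser :: "real \<Rightarrow> (complex \<Rightarrow> complex \<Rightarrow> complex) \<Rightarrow> bool" where
  "lser r G \<longleftrightarrow> (\<exists>a b. pser r (\<lambda>s t. s ^ a * t ^ b * G s t))"

lemma lser_cong:
  assumes "lser r G" "\<And>s t. s \<noteq> 0 \<Longrightarrow> t \<noteq> 0 \<Longrightarrow> cmod s + r * cmod t < 1 \<Longrightarrow> G s t = G' s t"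
  shows "lser r G'"
proof -
  obtain a b where "pser r (\<lambda>s t. s ^ a * t ^ b * G s t)"
    using assms(1) unfolding lser_def by blast
  then have "pser r (\<lambda>s t. s ^ a * t ^ b * G' s t)"
    by (rule pser_cong) (use assms(2) in auto)
  then show ?thesis unfolding lser_def by blast
qed

lemma pser_imp_lser: "pser r G \<Longrightarrow> lser r G"
  unfolding lser_def by (intro exI[of _ 0]) simp

lemma lser_const: "lser r (\<lambda>s t. c)"
  using pser_imp_lser[OF pser_monom[of r c 0 0]] by simp

lemma lser_s: "lser r (\<lambda>s t. s)"
  using pser_imp_lser[OF pser_monom[of r 1 1 0]] by simp

lemma lser_t: "lser r (\<lambda>s t. t)"
  using pser_imp_lser[OF pser_monom[of r 1 0 1]] by simp

lemma lser_inverse_s: "lser r (\<lambda>s t. 1 / s)"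
  unfolding lser_def
  by (rule exI[of _ 1], rule exI[of _ 0], rule pser_cong[OF pser_monom[of r 1 0 0]]) simp

lemma lser_inverse_t: "lser r (\<lambda>s t. 1 / t)"
  unfolding lser_def
  by (rule exI[of _ 0], rule exI[of _ 1], rule pser_cong[OF pser_monom[of r 1 0 0]]) simp

lemma lser_mult:
  assumes "lser r G" "lser r H"
  shows "lser r (\<lambda>s t. G s t * H s t)"
proof -
  obtain a b a' b' where "pser r (\<lambda>s t. s ^ a * t ^ b * G s t)" "pser r (\<lambda>s t. s ^ a' * t ^ b' * H s t)"
    using assms unfolding lser_def by blast
  from pser_mult[OF this] have "pser r (\<lambda>s t. s ^ (a + a') * t ^ (b + b') * (G s t * H s t))"
    by (simp add: power_add mult_ac)
  then show ?thesis unfolding lser_def by blast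
qed

lemma lser_add:
  assumes "lser r G" "lser r H"
  shows "lser r (\<lambda>s t. G s t + H s t)"
proof -
  obtain a b a' b' where *: "pser r (\<lambda>s t. s ^ a * t ^ b * G s t)" "pser r (\<lambda>s t. s ^ a' * t ^ b' * H s t)"
    using assms unfolding lser_def by blast
  have "pser r (\<lambda>s t. s ^ (a + a') * t ^ (b + b') * (G s t + H s t))"
    by (rule pser_cong[OF pser_add[OF
          pser_mult[OF pser_monom[of r 1 a' b'] *(1)] pser_mult[OF pser_monom[of r 1 a b] *(2)]]])
       (simp add: power_add algebra_simps)
  then show ?thesis unfolding lser_def by blast
qed

lemma lser_sum: "(\<And>i. i \<in> A \<Longrightarrow> lser r (G i)) \<Longrightarrow> lser r (\<lambda>s t. \<Sum>i\<in>A. G i s t)"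
  by (induction A rule: infinite_finite_induct) (auto intro: lser_const lser_add)

lemma lser_prod: "(\<And>i. i \<in> A \<Longrightarrow> lser r (G i)) \<Longrightarrow> lser r (\<lambda>s t. \<Prod>i\<in>A. G i s t)"
  by (induction A rule: infinite_finite_induct) (auto intro: lser_const lser_mult)

lemma lser_power: "lser r G \<Longrightarrow> lser r (\<lambda>s t. G s t ^ n)"
  by (induction n) (auto intro: lser_const lser_mult)

text \<open>The denominator is \<open>z1 - z\<close> for \<open>c = 1\<close> and
  \<open>z2 - z\<close> for \<open>c = 0\<close>; it equals
  \<open>(1 + c * s - z * t) / t\<close>.\<close>

lemma lser_inverse_minus_const:
  assumes "cmod z \<le> r" "cmod c \<le> 1"
  shows "lser r (\<lambda>s t. 1 / ((1 + c * s) / t - z))"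
  by (rule lser_cong[OF lser_mult[OF lser_t pser_imp_lser[OF pser_inverse_linear[OF assms]]]])
     (simp add: field_simps)

section \<open>Expansion of rational functions\<close>

text \<open>In terms of \<open>x = z1 - z2\<close> and \<open>y = z2\<close>, the monomial
  \<open>s^i * t^j\<close> is \<open>x^i * y^(-i-j)\<close>. A lower bound on the powers of
  \<open>s\<close> bounds \<open>k1\<close> above, and one on the powers of \<open>t\<close> bounds
  \<open>k1 + k2\<close> below; both truncations enter the comparison of coefficients.\<close>

lemma lser_expansion:
  assumes "lser r G" and r: "r \<ge> 0"
  shows "\<exists>B N M. (\<forall>k1 k2. k1 > N \<longrightarrow> B k1 k2 = 0) \<and> (\<forall>k1 k2. k1 + k2 < M \<longrightarrow> B k1 k2 = 0) \<and>
     (\<forall>x y. x \<noteq> 0 \<longrightarrow> cmod x + r < cmod y \<longrightarrow>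
       ((\<lambda>(k1, k2). B k1 k2 * (x powi (- k1 - 1) * y powi (- k2 - 1))) has_sum G (x / y) (1 / y)) UNIV)"
proof -
  obtain a b C where C: "pser_coeffs r C (\<lambda>s t. s ^ a * t ^ b * G s t)"
    using assms unfolding lser_def pser_def by blast
  \<comment> \<open>Obtained by solving \<open>- k1 - 1 = i - a\<close> and
    \<open>- k2 - 1 = a + b - i - j\<close> for \<open>i\<close> and \<open>j\<close>; the two
    conditions say \<open>i \<ge> 0\<close> and \<open>j \<ge> 0\<close>.\<close>
  define B where "B k1 k2 =
      (if k1 < int a \<and> k1 + k2 \<ge> - int b - 2 then C (nat (int a - k1 - 1), nat (k1 + k2 + int b + 2)) else 0)"
    for k1 k2 :: int
  have sums: "((\<lambda>(k1, k2). B k1 k2 * (x powi (- k1 - 1) * y powi (- k2 - 1))) has_sum G (x / y) (1 / y)) UNIV"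
    if x: "x \<noteq> 0" and xy: "cmod x + r < cmod y" for x y
  proof -
    have "cmod y > 0" using xy r norm_ge_zero[of x] by linarith
    then have y: "y \<noteq> 0" by simp
    define s t where "s = x / y" and "t = 1 / y"
    have st: "s \<noteq> 0" "t \<noteq> 0" using x y by (auto simp: s_def t_def)
    have "cmod s + r * cmod t = (cmod x + r) / cmod y"
      by (simp add: s_def t_def norm_divide add_divide_distrib)
    also have "\<dots> < 1" using xy y by simp
    finally have "((\<lambda>k. C k * (s ^ fst k * t ^ snd k)) has_sum s ^ a * t ^ b * G s t) UNIV"
      using pser_coeffsD[OF C st] by simp
    from has_sum_cmult_right[OF this, of "inverse (s ^ a * t ^ b)"]
    have *: "((\<lambda>k. inverse (s ^ a * t ^ b) * (C k * (s ^ fst k * t ^ snd k))) has_sum G s t) UNIV"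
      using st by (simp add: field_simps)
    let ?S = "{(k1, k2). k1 < int a \<and> k1 + k2 \<ge> - int b - 2}"
    have mono: "x powi (- (int a - 1 - int i) - 1) * y powi (- (int i + int j - int a - int b - 1) - 1) =
        inverse (s ^ a * t ^ b) * (s ^ i * t ^ j)" for i j
    proof -
      have "x powi (int i - int a) * y powi (- int i - int j + int a + int b) =
        (x powi int i * y powi (- int i) * y powi (- int j)) *
        (x powi (- int a) * y powi int a * y powi int b)"
        using x y by (simp add: power_int_add power_int_diff power_int_minus field_simps)
      also have "\<dots> = (s ^ i * t ^ j) * inverse (s ^ a * t ^ b)"
        using x y by (simp add: s_def t_def power_int_minus power_mult_distrib power_inverse divide_inverse mult_ac)
      finally show ?thesis by (simp add: algebra_simps)
    qed
    have "((\<lambda>(k1, k2). B k1 k2 * (x powi (- k1 - 1) * y powi (- k2 - 1))) has_sum G s t) ?S"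
      using *
    proof (rule has_sum_reindex_bij_witness[THEN iffD1, rotated -1])
      show "(case (int a - 1 - int (fst k), int (fst k) + int (snd k) - int a - int b - 1) of
          (k1, k2) \<Rightarrow> B k1 k2 * (x powi (- k1 - 1) * y powi (- k2 - 1))) =
        inverse (s ^ a * t ^ b) * (C k * (s ^ fst k * t ^ snd k))" for k
        using mono[of "fst k" "snd k"] by (simp add: B_def)
      show "(\<lambda>(k1, k2). (nat (int a - k1 - 1), nat (k1 + k2 + int b + 2)))
         (int a - 1 - int (fst k), int (fst k) + int (snd k) - int a - int b - 1) = k" for k
        by (cases k) auto
    qed auto
    then show ?thesis unfolding s_def t_def
      by (rule has_sum_cong_neutral[THEN iffD1, rotated -1]) (auto simp: B_def split: if_splits)
  qed
  show ?thesis
    by (rule exI[of _ B], rule exI[of _ "int a"], rule exI[of _ "- int b - 2"])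
       (use sums in \<open>auto simp: B_def\<close>)
qed

text \<open>With \<open>z1 = (1 + s) / t\<close> and \<open>z2 = 1 / t\<close>, the coordinates and
  the inverses of all their differences are Laurent series in \<open>s\<close> and \<open>t\<close>;
  the closure properties then give numerator and denominator.\<close>

lemma lser_rational_diag_poles:
  assumes R: "rational_diag_poles (Suc (Suc n)) R"
    and zs: "length zs = n" "distinct zs" "\<And>z. z \<in> set zs \<Longrightarrow> cmod z \<le> r"
  shows "lser r (\<lambda>s t. R ((1 + s) / t # 1 / t # zs))"
proof -
  define P where "P s t = (1 + s) / t # 1 / t # zs" for s t :: complex
  have len: "length (P s t) = Suc (Suc n)" for s t using zs by (simp add: P_def)
  obtain p b A c where p: "\<And>xs. length xs = Suc (Suc n) \<Longrightarrow> p xs = (\<Sum>\<alpha>\<in>A. c \<alpha> * mon xs \<alpha>)"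
    and Rp: "\<And>xs. xs \<in> config (Suc (Suc n)) \<Longrightarrow> R xs = p xs / pole_denom (\<lambda>_. 0) b xs"
    using R unfolding rational_diag_poles_def polyfun_def by blast
  have t_inv: "lser r (\<lambda>s t. (1 + s) / t)"
    by (rule lser_cong[OF lser_mult[OF lser_add[OF lser_const[of r 1] lser_s] lser_inverse_t]]) simp
  have coord: "lser r (\<lambda>s t. P s t ! i)" for i
    by (cases i; cases "i - 1") (auto simp: P_def lser_const lser_inverse_t t_inv)
  have num: "lser r (\<lambda>s t. \<Sum>\<alpha>\<in>A. c \<alpha> * (\<Prod>i<Suc (Suc n). (P s t ! i) ^ (\<alpha> ! i)))"
    by (intro lser_sum lser_mult lser_const lser_prod lser_power coord)
  have inv: "lser r (\<lambda>s t. 1 / (P s t ! i - P s t ! j))" if ij: "i < j" "j < Suc (Suc n)" for i j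
  proof -
    consider "i = 0" "j = 1" | k where "i = 0" "j = Suc (Suc k)" | k where "i = 1" "j = Suc (Suc k)"
      | l k where "i = Suc (Suc l)" "j = Suc (Suc k)"
      using ij by (metis One_nat_def not0_implies_Suc not_less_zero less_Suc0 not_less_eq)
    then show ?thesis
    proof cases
      case 1
      show ?thesis
        by (rule lser_cong[OF lser_mult[OF lser_t lser_inverse_s]])
           (simp add: 1 P_def field_simps)
    next
      case (2 k)
      then show ?thesis
        using lser_inverse_minus_const[of "zs ! k" r 1] zs ij by (simp add: P_def)
    next
      case (3 k)
      then show ?thesis
        using lser_inverse_minus_const[of "zs ! k" r 0] zs ij by (simp add: P_def)
    next
      case (4 l k)
      then show ?thesis by (simp add: P_def lser_const)
    qed
  qed
  have den: "lser r (\<lambda>s t. \<Prod>j<Suc (Suc n). \<Prod>i<j. (1 / (P s t ! i - P s t ! j)) ^ b i j)"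
    by (intro lser_prod lser_power inv) auto
  show ?thesis
  proof (rule lser_cong[OF lser_mult[OF num den]])
    fix s t :: complex assume st: "s \<noteq> 0" "t \<noteq> 0" "cmod s + r * cmod t < 1"
    \<comment> \<open>If \<open>1 / t\<close> or \<open>(1 + s) / t\<close> were equal to
      \<open>z\<close>, then |z t| would be 1 or |1 + s|, hence at least 1 - |s|. So neither meets a
      fixed point, and \<open>s \<noteq> 0\<close> keeps the two apart.\<close>
    have small: "cmod (z * t) < 1 - cmod s" if "z \<in> set zs" for z
    proof -
      have "cmod (z * t) \<le> r * cmod t"
        using zs(3)[OF that] by (simp add: norm_mult mult_right_mono)
      then show ?thesis using st by linarith
    qed
    have "1 / t \<notin> set zs"
      using small[of "1 / t"] st(2) norm_ge_zero[of s] by auto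
    moreover have "(1 + s) / t \<notin> set zs"
      using small[of "(1 + s) / t"] st(2) norm_diff_ineq[of 1 s] by auto
    ultimately have "P s t \<in> config (Suc (Suc n))"
      using zs st by (auto simp: config_def P_def field_simps)
    then have "R (P s t) = p (P s t) / pole_denom (\<lambda>_. 0) b (P s t)" by (rule Rp)
    then show "(\<Sum>\<alpha>\<in>A. c \<alpha> * (\<Prod>i<Suc (Suc n). (P s t ! i) ^ (\<alpha> ! i))) *
        (\<Prod>j<Suc (Suc n). \<Prod>i<j. (1 / (P s t ! i - P s t ! j)) ^ b i j) = R ((1 + s) / t # 1 / t # zs)"
      unfolding P_def[symmetric] p[OF len] pole_denom_def mon_def len
      by (simp only: power_one_over prod_dividef prod.neutral_const power_0 mult_1_left times_divide_eq_right
          mult_1_right)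
  qed
qed

section \<open>Uniqueness of Laurent coefficients\<close>

text \<open>Once the coefficients below \<open>n\<close> vanish, dividing by \<open>t ^ n\<close>
  leaves a power series that is zero for small positive \<open>t\<close>; continuity at 0 forces its
  constant term \<open>d n\<close> to vanish.\<close>

lemma power_series_eq_0_near_0:
  fixes d :: "nat \<Rightarrow> complex"
  assumes \<delta>: "\<delta> > 0"
    and d: "\<And>t. 0 < t \<Longrightarrow> t < \<delta> \<Longrightarrow> (\<lambda>n. d n * of_real t ^ n) sums 0"
  shows "d n = 0"
proof (induction n rule: less_induct)
  case (less n)
  define e where "e m = d (m + n)" for m
  have e: "(\<lambda>m. e m * of_real t ^ m) sums 0" if t: "0 < t" "t < \<delta>" for t
  proof -
    have "(\<lambda>m. d (m + n) * of_real t ^ (m + n)) sums 0"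
      using sums_split_initial_segment[OF d[OF t], of n] less.IH by simp
    then have "(\<lambda>m. inverse (of_real t ^ n) * (d (m + n) * of_real t ^ (m + n))) sums
        (inverse (of_real t ^ n) * 0)"
      by (rule sums_mult)
    then show ?thesis using t by (simp add: e_def power_add field_simps)
  qed
  define f where "f x = (\<Sum>m. e m * x ^ m)" for x
  have "(f \<longlongrightarrow> e 0) (at 0)"
  proof (rule powser_limit_0_strong)
    show "0 < \<delta> / 2" using \<delta> by simp
    fix x :: complex assume x: "norm x < \<delta> / 2"
    \<comment> \<open>Convergence at the single point \<open>\<delta> / 2\<close> gives convergence
      on the open complex disc of that radius, hence continuity at 0.\<close>
    have "summable (\<lambda>m. e m * of_real (\<delta> / 2) ^ m)"
      using e[of "\<delta> / 2"] \<delta> by (auto simp: sums_iff)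
    then have "summable (\<lambda>m. e m * x ^ m)"
      by (rule powser_inside) (use x \<delta> in simp)
    then show "(\<lambda>m. e m * x ^ m) sums f x" by (simp add: f_def summable_sums)
  qed
  moreover have "filterlim complex_of_real (at 0) (at_right 0)"
    by (auto simp: filterlim_at eventually_at_filter intro!: tendsto_eq_intros)
  ultimately have "((\<lambda>t. f (of_real t)) \<longlongrightarrow> e 0) (at_right 0)"
    by (rule filterlim_compose)
  moreover have "eventually (\<lambda>t. f (of_real t) = 0) (at_right 0)"
    unfolding eventually_at_right_field using \<delta> e
    by (intro exI[of _ \<delta>]) (auto simp: f_def sums_iff)
  then have "((\<lambda>t. f (of_real t)) \<longlongrightarrow> 0) (at_right 0)"
    by (rule tendsto_eventually)
  ultimately have "e 0 = 0"
    by (rule tendsto_unique[OF trivial_limit_at_right_real])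
  then show ?case by (simp add: e_def)
qed

text \<open>Truncation below lets multiplication by \<open>t powi (- M)\<close> turn the difference
  into a power series with sum 0. The common sum may depend on \<open>t\<close>, and only small
  positive real \<open>t\<close> are tested.\<close>

lemma laurent_coeffs_unique:
  fixes a b :: "int \<Rightarrow> complex"
  assumes \<delta>: "\<delta> > 0"
    and low: "\<And>k. k < M \<Longrightarrow> a k = 0" "\<And>k. k < M \<Longrightarrow> b k = 0"
    and sums: "\<And>t. 0 < t \<Longrightarrow> t < \<delta> \<Longrightarrow> \<exists>S. ((\<lambda>k. a k * of_real t powi k) has_sum S) UNIV \<and>
            ((\<lambda>k. b k * of_real t powi k) has_sum S) UNIV"
  shows "a k = b k"
proof (cases "k < M")
  case False
  define d where "d n = a (M + int n) - b (M + int n)" for n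
  have "d n = 0" for n
  proof (rule power_series_eq_0_near_0[OF \<delta>])
    fix t :: real assume t: "0 < t" "t < \<delta>"
    obtain S where S: "((\<lambda>k. a k * of_real t powi k) has_sum S) UNIV"
            "((\<lambda>k. b k * of_real t powi k) has_sum S) UNIV"
      using sums[OF t] by blast
    have "((\<lambda>k. (a k - b k) * of_real t powi k) has_sum 0) UNIV"
      using has_sum_add[OF S(1) has_sum_uminusI[OF S(2)]] by (simp add: algebra_simps)
    then have "((\<lambda>k. (a k - b k) * of_real t powi k) has_sum 0) {M..}"
      by (rule has_sum_cong_neutral[THEN iffD1, rotated -1]) (use low in auto)
    then have "((\<lambda>n. (a (M + int n) - b (M + int n)) * of_real t powi (M + int n)) has_sum 0) UNIV"
      by (rule has_sum_reindex_bij_witness[where i = "\<lambda>n. M + int n" and j = "\<lambda>k. nat (k - M)",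
            THEN iffD1, rotated -1]) auto
    then have "((\<lambda>n. of_real t powi (- M) * (d n * of_real t powi (M + int n))) has_sum
        of_real t powi (- M) * 0) UNIV"
      unfolding d_def by (rule has_sum_cmult_right)
    moreover have "of_real t powi (- M) * (d n * of_real t powi (M + int n)) = d n * of_real t ^ n" for n
      using t by (simp add: power_int_add power_int_minus)
    ultimately have "((\<lambda>n. d n * of_real t ^ n) has_sum 0) UNIV"
      by simp
    then show "(\<lambda>n. d n * of_real t ^ n) sums 0" by (rule has_sum_imp_sums)
  qed
  from this[of "nat (k - M)"] show ?thesis using False by (simp add: d_def)
qed (use low in auto)

text \<open>At the arguments \<open>u / t\<close> and \<open>1 / t\<close> a term carries
  \<open>t powi (k1 + k2 + 2)\<close>, so grouping by total degree yields a series in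
  \<open>t\<close> whose coefficients are antidiagonal sums. The 2 comes from the two exponents of
  the form \<open>- k - 1\<close>.\<close>

lemma has_sum_by_antidiagonals:
  fixes A :: "int \<Rightarrow> int \<Rightarrow> complex"
  assumes A: "((\<lambda>(k1, k2). A k1 k2 * ((u / t) powi (- k1 - 1) * (1 / t) powi (- k2 - 1))) has_sum H) UNIV"
    and t: "t \<noteq> 0"
  shows "(\<lambda>k. A k (K - k) * u powi (- k - 1)) summable_on UNIV"
    and "((\<lambda>j. (\<Sum>\<^sub>\<infinity>k. A k (j - 2 - k) * u powi (- k - 1)) * t powi j) has_sum H) UNIV"
proof -
  have eq: "A k1 k2 * ((u / t) powi (- k1 - 1) * (1 / t) powi (- k2 - 1)) =
      A k1 k2 * u powi (- k1 - 1) * t powi (k1 + k2 + 2)" for k1 k2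
  proof -
    have "t powi (- k1 - 1) * t powi (- k2 - 1) = t powi (- (k1 + k2 + 2))"
      using t by (simp add: algebra_simps flip: power_int_add)
    moreover have "(u / t) powi (- k1 - 1) * (1 / t) powi (- k2 - 1) =
        u powi (- k1 - 1) / (t powi (- k1 - 1) * t powi (- k2 - 1))"
      by (simp add: power_int_divide_distrib)
    ultimately show ?thesis
      by (simp only: power_int_minus divide_inverse inverse_inverse_eq mult.assoc)
  qed
  have *: "((\<lambda>(j, k). A k (j - 2 - k) * u powi (- k - 1) * t powi j) has_sum H) (UNIV \<times> UNIV)"
    using A unfolding eq
    by (rule has_sum_reindex_bij_witness[where i = "\<lambda>(j, k). (k, j - 2 - k)" and
          j = "\<lambda>(k1, k2). (k1 + k2 + 2, k1)", THEN iffD1, rotated -1]) auto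
  have summable: "(\<lambda>k. A k (j - 2 - k) * u powi (- k - 1)) summable_on UNIV" for j
  proof -
    have "(\<lambda>k. A k (j - 2 - k) * u powi (- k - 1) * t powi j) summable_on UNIV"
      using summable_on_SigmaD1[OF has_sum_imp_summable[OF *]] by simp
    from summable_on_cmult_left[OF this, of "inverse (t powi j)"] show ?thesis
      using t by (simp add: field_simps)
  qed
  from this[of "K + 2"] show "(\<lambda>k. A k (K - k) * u powi (- k - 1)) summable_on UNIV"
    by simp
  show "((\<lambda>j. (\<Sum>\<^sub>\<infinity>k. A k (j - 2 - k) * u powi (- k - 1)) * t powi j) has_sum H) UNIV"
    by (rule has_sum_SigmaD[OF *]) (use has_sum_cmult_left[OF has_sum_infsum[OF summable]] in simp)
qed

section \<open>Graded spaces and modes\<close>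

context graded_space
begin

lemma component_eqI:
  assumes "finite S" "\<And>m. c m \<in> G m" "\<And>m. m \<notin> S \<Longrightarrow> c m = 0" "w = (\<Sum>m\<in>S. c m)"
  shows "component G w = c"
proof -
  have "{m. c m \<noteq> 0} \<subseteq> S" using assms(3) by blast
  with assms have "decomposition G w c"
    unfolding decomposition_def
    by (auto intro: finite_subset intro!: sum.mono_neutral_right)
  then show ?thesis
    unfolding component_def using direct_sum by (blast intro: the1_equality)
qed

lemma decomposition_component: "decomposition G w (component G w)"
  unfolding component_def using direct_sum by (rule theI')

lemma component_in: "component G w m \<in> G m"
  and finite_component: "finite {m. component G w m \<noteq> 0}"
  and sum_component: "w = (\<Sum>m | component G w m \<noteq> 0. component G w m)"
  using decomposition_component[of w] unfolding decomposition_def by blast+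

lemma sum_component_superset:
  assumes "finite S" "{m. component G w m \<noteq> 0} \<subseteq> S"
  shows "w = (\<Sum>m\<in>S. component G w m)"
  by (subst sum_component) (use assms in \<open>auto intro: sum.mono_neutral_left\<close>)

lemma zero_in: "0 \<in> G m"
  using subspace_G subspace_0 by blast

lemma component_homogeneous:
  assumes "w \<in> G l"
  shows "component G w m = (if m = l then w else 0)"
proof -
  have "component G w = (\<lambda>m. if m = l then w else 0)"
    by (rule component_eqI[where S = "{l}"]) (use assms zero_in in auto)
  then show ?thesis by simp
qed

lemma component_zero: "component G 0 m = 0"
  using component_homogeneous[OF zero_in] by auto

lemma component_add: "component G (w + w') m = component G w m + component G w' m"
proof -
  let ?S = "{m. component G w m \<noteq> 0} \<union> {m. component G w' m \<noteq> 0}"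
  have fin: "finite ?S" using finite_component by blast
  have "component G (w + w') = (\<lambda>m. component G w m + component G w' m)"
  proof (rule component_eqI[OF fin])
    show "component G w m + component G w' m \<in> G m" for m
      using component_in subspace_G subspace_add by blast
    show "w + w' = (\<Sum>m\<in>?S. component G w m + component G w' m)"
      using sum_component_superset[OF fin, of w] sum_component_superset[OF fin, of w']
      by (simp add: sum.distrib)
  qed auto
  then show ?thesis by simp
qed

lemma component_scale: "component G (scale c w) m = scale c (component G w m)"
proof -
  have "component G (scale c w) = (\<lambda>m. scale c (component G w m))"
  proof (rule component_eqI[OF finite_component[of w]])
    show "scale c (component G w m) \<in> G m" for m
      using component_in subspace_G subspace_scale by blast
    show "scale c w = (\<Sum>m | component G w m \<noteq> 0. scale c (component G w m))"
      by (subst sum_component) (rule scale_sum_right)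
  qed auto
  then show ?thesis by simp
qed

lemma component_sum: "component G (\<Sum>i\<in>A. w i) m = (\<Sum>i\<in>A. component G (w i) m)"
  by (induction A rule: infinite_finite_induct)
     (auto simp: component_add component_zero)

lemma grading_op_homogeneous: "w \<in> G m \<Longrightarrow> grading_op scale wt G w = scale (wt m) w"
  unfolding grading_op_def by (cases "w = 0") (simp_all add: component_homogeneous)

text \<open>Comparing components of degree \<open>l\<close> shows that \<open>wt l\<close> and
  \<open>wt m\<close> scale them equally, so injectivity kills those with
  \<open>l \<noteq> m\<close>. This turns commutators with the grading operators into weights of
  modes.\<close>

lemma grading_op_eigenvector:
  assumes wt: "inj wt" and w: "grading_op scale wt G w = scale (wt m) w"
  shows "w \<in> G m"
proof -
  have "component G (grading_op scale wt G w) l = scale (wt l) (component G w l)" for l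
    unfolding grading_op_def component_sum component_scale
    using finite_component[of w]
    by (simp add: component_homogeneous[OF component_in] if_distrib sum.If_cases cong: if_cong)
  then have "scale (wt m) (component G w l) = scale (wt l) (component G w l)" for l
    using w component_scale by metis
  then have "component G w l = 0" if "l \<noteq> m" for l
    using that wt by (metis injD scale_right_imp_eq)
  then have "{l. component G w l \<noteq> 0} \<subseteq> {m}" by blast
  from sum_component_superset[OF _ this] show ?thesis
    using component_in[of w m] by simp
qed

lemma graded_dual_linear:
  assumes "\<phi> \<in> graded_dual scale G"
  shows "\<phi> (sum g A) = (\<Sum>i\<in>A. \<phi> (g i))" "\<phi> 0 = 0"
proof -
  interpret \<phi>: Vector_Spaces.linear scale "(*)" \<phi>
    using assms unfolding graded_dual_def by blast
  show "\<phi> (sum g A) = (\<Sum>i\<in>A. \<phi> (g i))" "\<phi> 0 = 0"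
    by (rule \<phi>.sum \<phi>.zero)+
qed

text \<open>Projecting to one degree before applying \<open>\<phi>\<close> isolates the terms of one
  total degree in a two-variable series.\<close>

lemma graded_dual_component:
  assumes "\<phi> \<in> graded_dual scale G"
  shows "(\<lambda>w. \<phi> (component G w l)) \<in> graded_dual scale G"
proof -
  have "Vector_Spaces.linear scale (*) \<phi>"
    using assms unfolding graded_dual_def by blast
  then interpret \<phi>: Vector_Spaces.linear scale "(*)" \<phi> .
  have "Vector_Spaces.linear scale (*) (\<lambda>w. \<phi> (component G w l))"
    by unfold_locales (simp_all add: component_add component_scale \<phi>.add \<phi>.scale)
  moreover have "{m. \<exists>w\<in>G m. \<phi> (component G w l) \<noteq> 0} \<subseteq> {l}"
    using \<phi>.zero by (auto simp: component_homogeneous split: if_splits)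
  then have "finite {m. \<exists>w\<in>G m. \<phi> (component G w l) \<noteq> 0}"
    by (rule finite_subset) simp
  ultimately show ?thesis unfolding graded_dual_def by blast
qed

lemma pair_completion:
  assumes "\<phi> \<in> graded_dual scale G" "f \<in> completion G"
  shows "pair \<phi> f = (\<Sum>m | \<exists>w\<in>G m. \<phi> w \<noteq> 0. \<phi> (f m))"
  unfolding pair_def
  by (rule sum.mono_neutral_left)
     (use assms in \<open>auto simp: graded_dual_def completion_def\<close>)

end

text \<open>Each \<open>B p\<close> shifts degrees by \<open>d p\<close>, so in degree
  \<open>m\<close> it only sees \<open>f (m - d p)\<close>. The action on the completion becomes an
  explicit finite sum.\<close>

lemma extend_op_sum_homogeneous:
  fixes G :: "'i::ab_group_add \<Rightarrow> 'b::ab_group_add set"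
  assumes "graded_space sc G" and P: "finite P"
    and A: "\<And>l w. w \<in> G l \<Longrightarrow> A w = (\<Sum>p\<in>P. B p w)"
    and B: "\<And>p l w. p \<in> P \<Longrightarrow> w \<in> G l \<Longrightarrow> B p w \<in> G (l + d p)"
    and f: "f \<in> completion G"
  shows "extend_op G A f = (\<lambda>m. \<Sum>p\<in>P. B p (f (m - d p)))"
proof
  fix m
  interpret graded_space sc G by fact
  have fl: "f l \<in> G l" for l using f unfolding completion_def by blast
  have comp: "component G (A (f l)) m = (\<Sum>p\<in>P. if l = m - d p then B p (f l) else 0)" for l
    unfolding A[OF fl] component_sum
    by (rule sum.cong) (use component_homogeneous[OF B[OF _ fl]] in \<open>auto simp: algebra_simps\<close>)
  let ?I = "(\<lambda>p. m - d p) ` P"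
  have "extend_op G A f m = (\<Sum>l\<in>?I. component G (A (f l)) m)"
    unfolding extend_op_def
  proof (rule sum.mono_neutral_left)
    show "{l. component G (A (f l)) m \<noteq> 0} \<subseteq> ?I"
    proof
      fix l assume "l \<in> {l. component G (A (f l)) m \<noteq> 0}"
      then obtain p where "p \<in> P" "(if l = m - d p then B p (f l) else 0) \<noteq> 0"
        unfolding comp by (blast dest: sum.not_neutral_contains_not_neutral)
      then show "l \<in> ?I" by (auto split: if_splits)
    qed
  qed (use P in auto)
  also have "\<dots> = (\<Sum>p\<in>P. \<Sum>l\<in>?I. if l = m - d p then B p (f l) else 0)"
    unfolding comp by (rule sum.swap)
  also have "\<dots> = (\<Sum>p\<in>P. B p (f (m - d p)))"
    using P by (intro sum.cong refl) simp
  finally show "extend_op G A f m = (\<Sum>p\<in>P. B p (f (m - d p)))" .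
qed

section \<open>Sums over pairs of mode indices\<close>

lemma abs_converges_to_iff_has_sum:
  "abs_converges_to T zs s \<longleftrightarrow> (laurent_term T zs has_sum s) {ks. length ks = length zs}"
  unfolding abs_converges_to_def
  using summable_on_iff_abs_summable_on_complex has_sum_imp_summable by blast

lemma laurent_term_2: "laurent_term T [x, y] [k1, k2] = T [k1, k2] * (x powi (- k1 - 1) * y powi (- k2 - 1))"
  by (simp add: laurent_term_def lessThan_Suc mult_ac)

lemma abs_converges_to_2:
  "abs_converges_to T [x, y] s \<longleftrightarrow>
     ((\<lambda>(k1, k2). T [k1, k2] * (x powi (- k1 - 1) * y powi (- k2 - 1))) has_sum s) UNIV"
  unfolding abs_converges_to_iff_has_sum
proof (rule has_sum_reindex_bij_witness[where i = "\<lambda>(k1, k2). [k1, k2]" and j = "\<lambda>ks. (ks ! 0, ks ! 1)"])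
  fix ks :: "int list" assume "ks \<in> {ks. length ks = length [x, y]}"
  then obtain k1 k2 where ks: "ks = [k1, k2]" by (auto simp: length_Suc_conv)
  show "(case (ks ! 0, ks ! 1) of (k1, k2) \<Rightarrow> [k1, k2]) = ks" by (simp add: ks)
  show "(case (ks ! 0, ks ! 1) of (k1, k2) \<Rightarrow> T [k1, k2] * (x powi (- k1 - 1) * y powi (- k2 - 1))) =
      laurent_term T [x, y] ks" by (simp add: ks laurent_term_2)
qed auto

text \<open>At second variable 1, a family supported on \<open>k1 + k2 = K\<close> is a series in
  the first variable alone.\<close>

lemma has_sum_antidiagonal:
  fixes T :: "int \<Rightarrow> int \<Rightarrow> complex"
  assumes "((\<lambda>(k1, k2). T k1 k2 * (x powi (- k1 - 1) * 1 powi (- k2 - 1))) has_sum s) UNIV"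
    and "\<And>k1 k2. k1 + k2 \<noteq> K \<Longrightarrow> T k1 k2 = 0"
  shows "((\<lambda>k. T k (K - k) * x powi (- k - 1)) has_sum s) UNIV"
proof -
  have "((\<lambda>(k1, k2). T k1 k2 * x powi (- k1 - 1)) has_sum s) {(k1, k2). k1 + k2 = K}"
    by (rule has_sum_cong_neutral[THEN iffD1, OF _ _ _ assms(1)]) (use assms(2) in auto)
  then show ?thesis
    by (rule has_sum_reindex_bij_witness[where i = "\<lambda>k. (k, K - k)" and j = fst, THEN iffD1, rotated -1]) auto
qed

lemma has_sum_sum:
  fixes f :: "'a \<Rightarrow> 'b \<Rightarrow> complex"
  shows "(\<And>i. i \<in> I \<Longrightarrow> (f i has_sum s i) A) \<Longrightarrow> ((\<lambda>x. \<Sum>i\<in>I. f i x) has_sum (\<Sum>i\<in>I. s i)) A"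
  by (induction I rule: infinite_finite_induct) (auto intro: has_sum_add)

section \<open>Weights of the modes of \<open>Y\<close> and \<open>YL\<close>\<close>

context mosva
begin

text \<open>The commutator with the grading operator makes \<open>Y k u v\<close> an eigenvector
  with eigenvalue \<open>a + b - k - 1\<close>, and eigenvectors are homogeneous.\<close>

lemma Y_weight:
  assumes "u \<in> V a" "v \<in> V b"
  shows "Y k u v \<in> V (a + b - k - 1)"
proof (rule grading_op_eigenvector[of of_int])
  interpret R: Vector_Spaces.linear sV sV "Y k u" by (rule Y_linear_right)
  interpret L: Vector_Spaces.linear sV sV "\<lambda>u. Y k u v" by (rule Y_linear_left)
  have "mosva_d sV V (Y k u v) =
      sV (of_int (- k - 1)) (Y k u v) + Y k (mosva_d sV V u) v + Y k u (mosva_d sV V v)"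
    using d_commutator[of k u v] by (simp only: diff_eq_eq)
  also have "\<dots> = sV (of_int (a + b - k - 1)) (Y k u v)"
    by (simp add: grading_op_homogeneous[OF assms(1)] grading_op_homogeneous[OF assms(2)]
        R.scale L.scale flip: scale_left_distrib)
  finally show "mosva_d sV V (Y k u v) = sV (of_int (a + b - k - 1)) (Y k u v)" .
qed (auto simp: inj_def)

lemma Y_sum:
  "Y k (\<Sum>i\<in>A. u i) (\<Sum>j\<in>B. v j) = (\<Sum>i\<in>A. \<Sum>j\<in>B. Y k (u i) (v j))"
proof -
  have R: "Y k x (sum v B) = (\<Sum>j\<in>B. Y k x (v j))" for x
  proof -
    interpret Vector_Spaces.linear sV sV "Y k x" by (rule Y_linear_right)
    show ?thesis by (rule sum)
  qed
  interpret L: Vector_Spaces.linear sV sV "\<lambda>x. Y k x (sum v B)" by (rule Y_linear_left)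
  show ?thesis using L.sum[of u A] by (simp add: R)
qed

end

context mosva_bimodule
begin

lemma YL_weight:
  assumes "u \<in> V a" "w \<in> W m"
  shows "YL k u w \<in> W (m + of_int (a - k - 1))"
proof (rule W.grading_op_eigenvector[of "\<lambda>m. m"])
  interpret R: Vector_Spaces.linear sW sW "YL k u" by (rule YL_linear_right)
  interpret L: Vector_Spaces.linear sV sW "\<lambda>u. YL k u w" by (rule YL_linear_left)
  have "module_d sW W (YL k u w) =
      YL k (mosva_d sV V u) w + sW (of_int (- k - 1)) (YL k u w) + YL k u (module_d sW W w)"
    using L_d_commutator[of k u w] by (simp only: diff_eq_eq)
  also have "\<dots> = sW (m + of_int (a - k - 1)) (YL k u w)"
    by (simp add: grading_op_homogeneous[OF assms(1)] W.grading_op_homogeneous[OF assms(2)]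
        R.scale L.scale flip: W.scale_left_distrib)
  finally show "module_d sW W (YL k u w) = sW (m + of_int (a - k - 1)) (YL k u w)" .
qed auto

lemma YL_sum_left: "YL k (\<Sum>i\<in>A. u i) w = (\<Sum>i\<in>A. YL k (u i) w)"
proof -
  interpret L: Vector_Spaces.linear sV sW "\<lambda>u. YL k u w" by (rule YL_linear_left)
  show ?thesis by (rule L.sum)
qed

lemma YL_sum_right: "YL k u (\<Sum>i\<in>A. w i) = (\<Sum>i\<in>A. YL k u (w i))"
proof -
  interpret L: Vector_Spaces.linear sW sW "YL k u" by (rule YL_linear_right)
  show ?thesis by (rule L.sum)
qed

text \<open>The terms with \<open>k\<^sub>1 + k\<^sub>2 = K\<close> are homogeneous of degree \<open>-K - 2\<close> in \<open>z\<^sub>1\<close> and \<open>z\<^sub>2\<close>, so it suffices to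
  consider \<open>z\<^sub>2 = 1\<close> and \<open>z\<^sub>1 = 1 + \<epsilon>\<close>.\<close>

lemma associativity_homogeneous:
  assumes \<phi>: "\<phi> \<in> graded_dual sW W"
    and u: "u1 \<in> V a" "u2 \<in> V b" and w: "w \<in> W (l - of_int (a + b - K - 2))"
    and \<epsilon>: "0 < \<epsilon>" "\<epsilon> < 1"
  shows "\<exists>s. ((\<lambda>k. \<phi> (YL k u1 (YL (K - k) u2 w)) * of_real (1 + \<epsilon>) powi (- k - 1)) has_sum s) UNIV \<and>
             ((\<lambda>k. \<phi> (YL (K - k) (Y k u1 u2) w) * of_real \<epsilon> powi (- k - 1)) has_sum s) UNIV"
proof -
  \<comment> \<open>Both \<open>YL k1 u1 (YL k2 u2 w)\<close> and
    \<open>YL k2 (Y k1 u1 u2) w\<close> have degree \<open>l + K - k1 - k2\<close>, so projecting to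
    degree \<open>l\<close> keeps exactly the antidiagonal \<open>k1 + k2 = K\<close>.\<close>
  define \<psi> where "\<psi> x = \<phi> (component W x l)" for x
  have \<psi>: "\<psi> \<in> graded_dual sW W"
    unfolding \<psi>_def by (rule W.graded_dual_component[OF \<phi>])
  define T where "T k1 k2 = \<psi> (YL k1 u1 (YL k2 u2 w))" for k1 k2
  define S where "S k1 k2 = \<psi> (YL k2 (Y k1 u1 u2) w)" for k1 k2
  have T_in: "YL k1 u1 (YL k2 u2 w) \<in> W (l + of_int (K - k1 - k2))" for k1 k2
    using YL_weight[OF u(1) YL_weight[OF u(2) w], of k1 k2] by (simp add: algebra_simps)
  have S_in: "YL k2 (Y k1 u1 u2) w \<in> W (l + of_int (K - k1 - k2))" for k1 k2
    using YL_weight[OF Y_weight[OF u] w, of k2 k1] by (simp add: algebra_simps)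
  have eq_iff: "l = l + of_int (K - k1 - k2) \<longleftrightarrow> k1 + k2 = K" for k1 k2
    by (metis add_cancel_left_right diff_diff_eq eq_iff_diff_eq_0 of_int_eq_0_iff)
  have zero: "T k1 k2 = 0" "S k1 k2 = 0" if "k1 + k2 \<noteq> K" for k1 k2
    unfolding T_def S_def \<psi>_def W.component_homogeneous[OF T_in] W.component_homogeneous[OF S_in] eq_iff
    using that W.graded_dual_linear(2)[OF \<phi>] by auto
  have diag: "T k (K - k) = \<phi> (YL k u1 (YL (K - k) u2 w))" "S k (K - k) = \<phi> (YL (K - k) (Y k u1 u2) w)" for k
    unfolding T_def S_def \<psi>_def W.component_homogeneous[OF T_in] W.component_homogeneous[OF S_in] eq_iff
    by simp_all
  have \<epsilon>': "complex_of_real (1 + \<epsilon>) - 1 = of_real \<epsilon>" by simp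
  have "cmod (of_real (1 + \<epsilon>)) > cmod 1" "cmod 1 > cmod (of_real (1 + \<epsilon>) - 1)" "cmod (of_real (1 + \<epsilon>) - 1) > 0"
    unfolding \<epsilon>' norm_of_real norm_one using \<epsilon> by auto
  with L_associativity[OF \<psi>, of u1 u2 w] obtain s where
    s: "abs_converges_to (\<lambda>ks. \<psi> (modes YL [u1, u2] ks w)) [of_real (1 + \<epsilon>), 1] s"
       "abs_converges_to (\<lambda>ks. \<psi> (YL (ks ! 1) (Y (ks ! 0) u1 u2) w)) [of_real (1 + \<epsilon>) - 1, 1] s"
    unfolding agree_on_overlap_def by blast
  have "((\<lambda>k. T k (K - k) * of_real (1 + \<epsilon>) powi (- k - 1)) has_sum s) UNIV"
    using s(1) zero(1) unfolding abs_converges_to_2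
    by (intro has_sum_antidiagonal) (simp_all add: modes_def T_def)
  moreover have "((\<lambda>k. S k (K - k) * (of_real (1 + \<epsilon>) - 1) powi (- k - 1)) has_sum s) UNIV"
    using s(2) zero(2) unfolding abs_converges_to_2
    by (intro has_sum_antidiagonal) (simp_all add: S_def)
  ultimately show ?thesis unfolding diag by auto
qed

section \<open>Coefficients of the product and iterate series on the completion\<close>

definition product_coeff :: "('w \<Rightarrow> complex) \<Rightarrow> 'v \<Rightarrow> 'v \<Rightarrow> (complex \<Rightarrow> 'w) \<Rightarrow> int \<Rightarrow> int \<Rightarrow> complex" where
  "product_coeff \<phi> v1 v2 f k1 k2 = pair \<phi> (extend_op W (YL k1 v1) (extend_op W (YL k2 v2) f))"

definition iterate_coeff :: "('w \<Rightarrow> complex) \<Rightarrow> 'v \<Rightarrow> 'v \<Rightarrow> (complex \<Rightarrow> 'w) \<Rightarrow> int \<Rightarrow> int \<Rightarrow> complex" where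
  "iterate_coeff \<phi> v1 v2 f k1 k2 = pair \<phi> (extend_op W (YL k2 (Y k1 v1 v2)) f)"

text \<open>A triple consists of a degree seen by \<open>\<phi>\<close> and of weights present in
  \<open>v1\<close> and \<open>v2\<close>. This one index set serves both series and all mode
  indices.\<close>

definition weights :: "('w \<Rightarrow> complex) \<Rightarrow> 'v \<Rightarrow> 'v \<Rightarrow> (complex \<times> int \<times> int) set" where
  "weights \<phi> v1 v2 = {m. \<exists>w\<in>W m. \<phi> w \<noteq> 0} \<times> {a. component V v1 a \<noteq> 0} \<times> {b. component V v2 b \<noteq> 0}"

lemma finite_weights: "\<phi> \<in> graded_dual sW W \<Longrightarrow> finite (weights \<phi> v1 v2)"
  unfolding weights_def graded_dual_def by (auto intro!: finite_component)

text \<open>The degree at which \<open>f\<close> is evaluated depends on \<open>k1\<close> and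
  \<open>k2\<close> only through their sum. Along an antidiagonal both series thus involve the same
  finitely many components of \<open>f\<close>, which are elements of the module itself.\<close>

lemma
  assumes \<phi>: "\<phi> \<in> graded_dual sW W" and f: "f \<in> completion W"
  shows product_coeff_eq: "product_coeff \<phi> v1 v2 f k1 k2 =
      (\<Sum>(l, a, b)\<in>weights \<phi> v1 v2. \<phi> (YL k1 (component V v1 a) (YL k2 (component V v2 b)
         (f (l - of_int (a + b - (k1 + k2) - 2))))))" (is "_ = ?P")
    and iterate_coeff_eq: "iterate_coeff \<phi> v1 v2 f k1 k2 =
      (\<Sum>(l, a, b)\<in>weights \<phi> v1 v2. \<phi> (YL k2 (Y k1 (component V v1 a) (component V v2 b))
         (f (l - of_int (a + b - (k1 + k2) - 2)))))" (is "_ = ?I")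
proof -
  let ?c1 = "component V v1" and ?c2 = "component V v2"
  let ?A = "{a. ?c1 a \<noteq> 0}" and ?B = "{b. ?c2 b \<noteq> 0}" and ?L = "{m. \<exists>w\<in>W m. \<phi> w \<noteq> 0}"
  have fm: "f m \<in> W m" for m using f unfolding completion_def by blast
  note W = W.graded_space_axioms
  have ext: "extend_op W (YL k v) g = (\<lambda>m. \<Sum>a | component V v a \<noteq> 0.
      YL k (component V v a) (g (m - of_int (a - k - 1))))" if "g \<in> completion W" for k v g
  proof (rule extend_op_sum_homogeneous[OF W finite_component _ _ that])
    show "YL k v w = (\<Sum>a | component V v a \<noteq> 0. YL k (component V v a) w)" for w
      by (subst sum_component[of v]) (rule YL_sum_left)
  qed (rule YL_weight[OF component_in])
  have in2': "(\<Sum>b\<in>?B. YL k2 (?c2 b) (f (m - of_int (b - k2 - 1)))) \<in> W m" for m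
  proof -
    have "YL k2 (?c2 b) (f (m - of_int (b - k2 - 1))) \<in> W m" for b
      using YL_weight[OF component_in fm, of k2 v2 b "m - of_int (b - k2 - 1)"]
      by (simp only: diff_add_cancel)
    then show ?thesis using W.subspace_G by (intro W.subspace_sum) auto
  qed
  have in2: "(\<lambda>m. \<Sum>b\<in>?B. YL k2 (?c2 b) (f (m - of_int (b - k2 - 1)))) \<in> completion W"
    using in2' by (simp add: completion_def)
  have in1: "(\<lambda>m. \<Sum>a\<in>?A. YL k1 (?c1 a) (\<Sum>b\<in>?B. YL k2 (?c2 b)
      (f (m - of_int (a - k1 - 1) - of_int (b - k2 - 1))))) \<in> completion W"
    unfolding completion_def
  proof safe
    fix m
    have "YL k1 (?c1 a) (\<Sum>b\<in>?B. YL k2 (?c2 b)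
      (f (m - of_int (a - k1 - 1) - of_int (b - k2 - 1)))) \<in> W m" for a
      using YL_weight[OF component_in in2', of k1 v1 a "m - of_int (a - k1 - 1)"]
      by (simp only: diff_add_cancel)
    then show "(\<Sum>a\<in>?A. YL k1 (?c1 a) (\<Sum>b\<in>?B. YL k2 (?c2 b)
      (f (m - of_int (a - k1 - 1) - of_int (b - k2 - 1))))) \<in> W m"
      using W.subspace_G by (intro W.subspace_sum) auto
  qed
  have "product_coeff \<phi> v1 v2 f k1 k2 = (\<Sum>l\<in>?L. \<phi> (\<Sum>a\<in>?A. YL k1 (?c1 a) (\<Sum>b\<in>?B. YL k2 (?c2 b)
      (f (l - of_int (a - k1 - 1) - of_int (b - k2 - 1))))))"
    unfolding product_coeff_def ext[OF f] ext[OF in2] by (rule W.pair_completion[OF \<phi> in1])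
  then show "product_coeff \<phi> v1 v2 f k1 k2 = ?P"
    unfolding weights_def YL_sum_right W.graded_dual_linear(1)[OF \<phi>]
    by (simp add: sum.cartesian_product' algebra_simps)
  have ext2: "extend_op W (YL k2 (Y k1 v1 v2)) f = (\<lambda>m. \<Sum>p\<in>?A \<times> ?B.
      YL k2 (Y k1 (?c1 (fst p)) (?c2 (snd p))) (f (m - of_int (fst p + snd p - (k1 + k2) - 2))))"
  proof (rule extend_op_sum_homogeneous[OF W _ _ _ f])
    show "finite (?A \<times> ?B)" using finite_component by blast
    show "YL k2 (Y k1 v1 v2) w = (\<Sum>p\<in>?A \<times> ?B. YL k2 (Y k1 (?c1 (fst p)) (?c2 (snd p))) w)" for w
      by (subst sum_component[of v1], subst sum_component[of v2])
         (simp add: Y_sum YL_sum_left sum.cartesian_product')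
    show "YL k2 (Y k1 (?c1 (fst p)) (?c2 (snd p))) w \<in> W (m + of_int (fst p + snd p - (k1 + k2) - 2))"
      if "w \<in> W m" for p m w
      using YL_weight[OF Y_weight[OF component_in component_in] that, of k2 k1 v1 "fst p" v2 "snd p"]
      by (simp add: algebra_simps)
  qed
  have in3: "(\<lambda>m. \<Sum>p\<in>?A \<times> ?B.
      YL k2 (Y k1 (?c1 (fst p)) (?c2 (snd p))) (f (m - of_int (fst p + snd p - (k1 + k2) - 2)))) \<in> completion W"
    unfolding completion_def
  proof safe
    fix m
    have "YL k2 (Y k1 (?c1 a) (?c2 b)) (f (m - of_int (a + b - (k1 + k2) - 2))) \<in> W m" for a b
      using YL_weight[OF Y_weight[OF component_in component_in] fm, of k2 k1 v1 a v2 b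
          "m - of_int (a + b - (k1 + k2) - 2)"] by (simp add: algebra_simps)
    then show "(\<Sum>p\<in>?A \<times> ?B. YL k2 (Y k1 (?c1 (fst p)) (?c2 (snd p)))
        (f (m - of_int (fst p + snd p - (k1 + k2) - 2)))) \<in> W m"
      using W.subspace_G by (intro W.subspace_sum) auto
  qed
  have "iterate_coeff \<phi> v1 v2 f k1 k2 = (\<Sum>l\<in>?L. \<phi> (\<Sum>p\<in>?A \<times> ?B.
      YL k2 (Y k1 (?c1 (fst p)) (?c2 (snd p))) (f (l - of_int (fst p + snd p - (k1 + k2) - 2)))))"
    unfolding iterate_coeff_def ext2 by (rule W.pair_completion[OF \<phi> in3])
  then show "iterate_coeff \<phi> v1 v2 f k1 k2 = ?I"
    unfolding weights_def W.graded_dual_linear(1)[OF \<phi>]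
    by (simp add: sum.cartesian_product')
qed

text \<open>For each triple in \<open>weights\<close>, the component of \<open>f\<close> is a fixed
  homogeneous vector along the antidiagonal, so \<open>associativity_homogeneous\<close> applies;
  the finitely many equalities are then added.\<close>

lemma associativity_antidiagonal:
  assumes \<phi>: "\<phi> \<in> graded_dual sW W" and f: "f \<in> completion W" and \<epsilon>: "0 < \<epsilon>" "\<epsilon> < 1"
  shows "\<exists>s. ((\<lambda>k. product_coeff \<phi> v1 v2 f k (K - k) * of_real (1 + \<epsilon>) powi (- k - 1)) has_sum s) UNIV \<and>
             ((\<lambda>k. iterate_coeff \<phi> v1 v2 f k (K - k) * of_real \<epsilon> powi (- k - 1)) has_sum s) UNIV"
proof -
  define T where "T p k = (case p of (l, a, b) \<Rightarrow> \<phi> (YL k (component V v1 a) (YL (K - k) (component V v2 b)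
         (f (l - of_int (a + b - K - 2))))))" for p k
  define S where "S p k = (case p of (l, a, b) \<Rightarrow> \<phi> (YL (K - k) (Y k (component V v1 a) (component V v2 b))
         (f (l - of_int (a + b - K - 2)))))" for p k
  have fm: "f m \<in> W m" for m using f unfolding completion_def by blast
  have "\<exists>s. ((\<lambda>k. T p k * of_real (1 + \<epsilon>) powi (- k - 1)) has_sum s) UNIV \<and>
            ((\<lambda>k. S p k * of_real \<epsilon> powi (- k - 1)) has_sum s) UNIV" for p
    using associativity_homogeneous[OF \<phi> component_in component_in fm \<epsilon>]
    by (cases p) (simp add: T_def S_def)
  then obtain s where s: "\<And>p. ((\<lambda>k. T p k * of_real (1 + \<epsilon>) powi (- k - 1)) has_sum s p) UNIV"
      "\<And>p. ((\<lambda>k. S p k * of_real \<epsilon> powi (- k - 1)) has_sum s p) UNIV"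
    by metis
  have "product_coeff \<phi> v1 v2 f k (K - k) = (\<Sum>p\<in>weights \<phi> v1 v2. T p k)"
    "iterate_coeff \<phi> v1 v2 f k (K - k) = (\<Sum>p\<in>weights \<phi> v1 v2. S p k)" for k
    by (simp_all add: product_coeff_eq[OF \<phi> f] iterate_coeff_eq[OF \<phi> f] T_def S_def)
  then show ?thesis
    using has_sum_sum[OF s(1), where I = "weights \<phi> v1 v2"] has_sum_sum[OF s(2), where I = "weights \<phi> v1 v2"]
    by (intro exI[of _ "sum s (weights \<phi> v1 v2)"]) (simp add: sum_distrib_right)
qed

text \<open>For very negative \<open>k1 + k2\<close>, the degrees at which \<open>f\<close> is
  evaluated have real part below the truncation bound of the module.\<close>

lemma product_coeff_lower_truncation:
  assumes \<phi>: "\<phi> \<in> graded_dual sW W" and f: "f \<in> completion W"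
  shows "\<exists>M. \<forall>k1 k2. k1 + k2 < M \<longrightarrow> product_coeff \<phi> v1 v2 f k1 k2 = 0"
proof -
  obtain N where N: "\<And>m. Re m < N \<Longrightarrow> W m = {0}" using W_lower_truncated by blast
  \<comment> \<open>Chosen so that \<open>k1 + k2 < M\<close> brings the real parts of these degrees
    below \<open>N\<close>; inserting 0 keeps \<open>Min\<close> meaningful when
    \<open>weights\<close> is empty.\<close>
  define M where "M = Min (insert 0 ((\<lambda>(l, a, b). \<lfloor>N - Re l\<rfloor> + a + b - 2) ` weights \<phi> v1 v2))"
  have zero: "f (l - of_int (a + b - (k1 + k2) - 2)) = 0"
    if "(l, a, b) \<in> weights \<phi> v1 v2" "k1 + k2 < M" for l a b k1 k2
  proof -
    have "M \<le> \<lfloor>N - Re l\<rfloor> + a + b - 2"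
      unfolding M_def
      by (rule Min_le) (use that finite_weights[OF \<phi>] in \<open>auto intro!: image_eqI[of _ _ "(l, a, b)"]\<close>)
    with that(2) have "k1 + k2 - a - b + 2 < \<lfloor>N - Re l\<rfloor>" by linarith
    then have "of_int (k1 + k2 - a - b + 2) < N - Re l" by linarith
    then have "Re (l - of_int (a + b - (k1 + k2) - 2)) < N" by simp
    then show ?thesis using N f unfolding completion_def by blast
  qed
  have YL0: "YL k u 0 = 0" for k u
    using YL_sum_right[of k u _ "{}"] by simp
  show ?thesis
    by (rule exI[of _ M])
       (auto simp: product_coeff_eq[OF \<phi> f] zero YL0 W.graded_dual_linear(2)[OF \<phi>]
         simp del: of_int_diff of_int_add intro!: sum.neutral)
qed

text \<open>For large \<open>k1\<close>, the inner mode \<open>Y k1\<close> lands in weights where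
  the algebra vanishes, whatever \<open>k2\<close> is.\<close>

lemma iterate_coeff_upper_truncation:
  assumes \<phi>: "\<phi> \<in> graded_dual sW W" and f: "f \<in> completion W"
  shows "\<exists>N. \<forall>k1 k2. k1 > N \<longrightarrow> iterate_coeff \<phi> v1 v2 f k1 k2 = 0"
proof -
  obtain M where M: "\<And>n. n < M \<Longrightarrow> V n = {0}" using lower_truncated by blast
  define N where "N = Max (insert 0 ((\<lambda>(l, a, b). a + b - M) ` weights \<phi> v1 v2))"
  have zero: "Y k1 (component V v1 a) (component V v2 b) = 0"
    if "(l, a, b) \<in> weights \<phi> v1 v2" "k1 > N" for l a b k1
  proof -
    have "a + b - M \<le> N"
      unfolding N_def
      by (rule Max_ge) (use that finite_weights[OF \<phi>] in \<open>auto intro!: image_eqI[of _ _ "(l, a, b)"]\<close>)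
    with that(2) have "a + b - k1 - 1 < M" by linarith
    then show ?thesis using M Y_weight[OF component_in component_in, of k1 v1 a v2 b] by auto
  qed
  have YL0: "YL k 0 w = 0" for k w
    using YL_sum_left[of k _ "{}" w] by simp
  show ?thesis
    by (rule exI[of _ N])
       (auto simp: iterate_coeff_eq[OF \<phi> f] zero YL0 W.graded_dual_linear(2)[OF \<phi>]
         simp del: of_int_diff of_int_add intro!: sum.neutral)
qed

end

section \<open>Comparison of the expansion of the rational limit with the iterate series\<close>

theorem proposition3p18:
  fixes sV :: "complex \<Rightarrow> 'v::ab_group_add \<Rightarrow> 'v" and V :: "int \<Rightarrow> 'v set"
    and Y :: "int \<Rightarrow> 'v \<Rightarrow> 'v \<Rightarrow> 'v" and vac :: 'v
    and sW :: "complex \<Rightarrow> 'w::ab_group_add \<Rightarrow> 'w" and W :: "complex \<Rightarrow> 'w set"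
    and DW :: "'w \<Rightarrow> 'w"
    and YL :: "int \<Rightarrow> 'v \<Rightarrow> 'w \<Rightarrow> 'w" and YR :: "int \<Rightarrow> 'w \<Rightarrow> 'v \<Rightarrow> 'w"
    and n :: nat and v1 v2 :: 'v
    and f h :: "complex list \<Rightarrow> complex \<Rightarrow> 'w"
  assumes "mosva sV V Y vac"
    and "mosva_bimodule sV V Y vac sW W DW YL YR"
    and "mosva_pole_order_condition sV V Y"
    and "bimodule_pole_order_condition Y sW W YL YR"
    and "n \<ge> 1"
    and "f \<in> rational_maps sW W n"
    and "h \<in> rational_maps sW W (n + 2)"
    and "\<And>z1 z2 zs. z1 # z2 # zs \<in> config (n + 2) \<Longrightarrow>
           cmod z1 > cmod z2 \<Longrightarrow> (\<forall>z\<in>set zs. cmod z2 > cmod z) \<Longrightarrow>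
           completion_converges_to sW W
             (\<lambda>ks. extend_op W (YL (ks ! 0) v1) (extend_op W (YL (ks ! 1) v2) (f zs)))
             [z1, z2] (h (z1 # z2 # zs))"
  shows "\<forall>z1 z2 zs. z1 # z2 # zs \<in> config (n + 2) \<longrightarrow>
           (\<forall>z\<in>set zs. cmod z2 > cmod (z1 - z2) + cmod z) \<longrightarrow>
           completion_converges_to sW W
             (\<lambda>ks. extend_op W (YL (ks ! 1) (Y (ks ! 0) v1 v2)) (f zs))
             [z1 - z2, z2] (h (z1 # z2 # zs))"
proof (intro allI impI)
  fix z1 z2 zs
  assume config: "z1 # z2 # zs \<in> config (n + 2)"
    and far: "\<forall>z\<in>set zs. cmod z2 > cmod (z1 - z2) + cmod z"
  interpret B: mosva_bimodule sV V Y vac sW W DW YL YR by fact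
  have zs: "length zs = n" "distinct zs" "zs \<noteq> []" "z1 \<noteq> z2"
    using config \<open>n \<ge> 1\<close> by (auto simp: config_def)
  \<comment> \<open>Since \<open>zs\<close> is nonempty, the maximum is attained, so the
    inequalities in \<open>far\<close> amount to one strict inequality with
    \<open>r\<close>.\<close>
  define r where "r = Max (cmod ` set zs)"
  have r: "cmod z \<le> r" if "z \<in> set zs" for z
    using that by (simp add: r_def)
  have r0: "r \<ge> 0"
    using order_trans[OF norm_ge_zero r[of "hd zs"]] zs by simp
  have "r \<in> cmod ` set zs"
    unfolding r_def by (rule Max_in) (use zs in auto)
  then have far': "cmod (z1 - z2) + r < cmod z2" using far by auto
  have f: "f zs \<in> completion W"
    using assms(6) zs unfolding rational_maps_def config_def by blast
  show "completion_converges_to sW W (\<lambda>ks. extend_op W (YL (ks ! 1) (Y (ks ! 0) v1 v2)) (f zs))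
      [z1 - z2, z2] (h (z1 # z2 # zs))"
    unfolding completion_converges_to_def
  proof
    fix \<phi> assume \<phi>: "\<phi> \<in> graded_dual sW W"
    define T where "T = B.product_coeff \<phi> v1 v2 (f zs)"
    define S where "S = B.iterate_coeff \<phi> v1 v2 (f zs)"
    define R where "R xs = pair \<phi> (h xs)" for xs
    have "rational_diag_poles (Suc (Suc n)) R"
      using assms(7) \<phi> unfolding rational_maps_def R_def by simp
    then have "lser r (\<lambda>s t. R ((1 + s) / t # 1 / t # zs))"
      using zs(1,2) r by (rule lser_rational_diag_poles)
    \<comment> \<open>The family \<open>B\<close> expands the rational limit in
      \<open>z1 - z2\<close> and \<open>z2\<close>; it remains to identify it with the coefficients
      \<open>S\<close> of the iterate series.\<close>
    from lser_expansion[OF this r0]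
    obtain B N M where trunc: "\<forall>k1 k2. k1 > N \<longrightarrow> B k1 k2 = 0" "\<forall>k1 k2. k1 + k2 < M \<longrightarrow> B k1 k2 = 0"
      and "\<forall>x y. x \<noteq> 0 \<longrightarrow> cmod x + r < cmod y \<longrightarrow>
       ((\<lambda>(k1, k2). B k1 k2 * (x powi (- k1 - 1) * y powi (- k2 - 1))) has_sum
          R ((1 + x / y) / (1 / y) # 1 / (1 / y) # zs)) UNIV"
      by (elim exE conjE)
    moreover have "(1 + x / y) / (1 / y) = x + y" if "cmod x + r < cmod y" for x y
    proof -
      have "cmod y > 0" using that r0 norm_ge_zero[of x] by linarith
      then show ?thesis by (simp add: field_simps)
    qed
    ultimately have B_sum: "((\<lambda>(k1, k2). B k1 k2 * (x powi (- k1 - 1) * y powi (- k2 - 1))) has_sum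
          R ((x + y) # y # zs)) UNIV" if "x \<noteq> 0" "cmod x + r < cmod y" for x y
      using that by simp
    have T_sum: "((\<lambda>(k1, k2). T k1 k2 * (x powi (- k1 - 1) * y powi (- k2 - 1))) has_sum
          R (x # y # zs)) UNIV" if xy: "cmod x > cmod y" "cmod y > r" for x y
    proof -
      have lt: "cmod z < cmod y" if "z \<in> set zs" for z using r[OF that] xy by linarith
      then have "x # y # zs \<in> config (n + 2)"
        using zs xy by (auto simp: config_def dest: less_asym)
      with assms(8)[OF this xy(1)] lt \<phi> show ?thesis
        by (simp add: completion_converges_to_def abs_converges_to_2 T_def B.product_coeff_def R_def)
    qed
    obtain M' where T_low: "\<forall>k1 k2. k1 + k2 < M' \<longrightarrow> T k1 k2 = 0"
      using B.product_coeff_lower_truncation[OF \<phi> f] unfolding T_def by blast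
    obtain N' where S_up: "\<forall>k1 k2. k1 > N' \<longrightarrow> S k1 k2 = 0"
      using B.iterate_coeff_upper_truncation[OF \<phi> f] unfolding S_def by blast

    text \<open>On \<open>z\<^sub>1 = (1 + \<epsilon>)/t\<close>, \<open>z\<^sub>2 = 1/t\<close> both expansions of \<open>R\<close> are Laurent series in \<open>t\<close>.\<close>
    have line: "\<exists>s. ((\<lambda>k. B k (K - k) * of_real \<epsilon> powi (- k - 1)) has_sum s) UNIV \<and>
        ((\<lambda>k. S k (K - k) * of_real \<epsilon> powi (- k - 1)) has_sum s) UNIV"
      if \<epsilon>: "0 < \<epsilon>" "\<epsilon> < 1" for K \<epsilon>
    proof -
      have "\<forall>K. \<exists>s. ((\<lambda>k. T k (K - k) * of_real (1 + \<epsilon>) powi (- k - 1)) has_sum s) UNIV \<and>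
          ((\<lambda>k. S k (K - k) * of_real \<epsilon> powi (- k - 1)) has_sum s) UNIV"
        using B.associativity_antidiagonal[OF \<phi> f \<epsilon>] unfolding T_def S_def by blast
      from choice[OF this] obtain s where
        s: "\<forall>K. ((\<lambda>k. T k (K - k) * of_real (1 + \<epsilon>) powi (- k - 1)) has_sum s K) UNIV \<and>
          ((\<lambda>k. S k (K - k) * of_real \<epsilon> powi (- k - 1)) has_sum s K) UNIV" ..
      define b where "b K = (\<Sum>\<^sub>\<infinity>k. B k (K - k) * of_real \<epsilon> powi (- k - 1))" for K
      \<comment> \<open>For \<open>0 < t < \<delta>\<close> this gives
        \<open>\<epsilon> + r * t < 1\<close>, which puts the point in the regions of both
        expansions; the summand 1 in \<open>r + 1\<close> covers \<open>r = 0\<close>.\<close>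
      define \<delta> where "\<delta> = (1 - \<epsilon>) / (r + 1)"
      have \<delta>: "\<delta> > 0" using \<epsilon> r0 by (simp add: \<delta>_def)
      have series: "((\<lambda>(k1, k2). B k1 k2 * ((of_real \<epsilon> / of_real t) powi (- k1 - 1) *
              (1 / of_real t) powi (- k2 - 1))) has_sum R (of_real (1 + \<epsilon>) / of_real t # 1 / of_real t # zs)) UNIV"
          "((\<lambda>(k1, k2). T k1 k2 * ((of_real (1 + \<epsilon>) / of_real t) powi (- k1 - 1) *
              (1 / of_real t) powi (- k2 - 1))) has_sum R (of_real (1 + \<epsilon>) / of_real t # 1 / of_real t # zs)) UNIV"
        if t: "0 < t" "t < \<delta>" for t :: real
      proof -
        have "t * (r + 1) < 1 - \<epsilon>" using t r0 by (simp add: \<delta>_def field_simps)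
        then have small: "\<epsilon> + r * t < 1" using t by (simp add: algebra_simps)
        from divide_strict_right_mono[OF small t(1)] have "\<epsilon> / t + r < 1 / t"
          using t by (simp add: add_divide_distrib)
        moreover have "complex_of_real \<epsilon> / of_real t + 1 / of_real t = of_real (1 + \<epsilon>) / of_real t"
          by (simp add: add_divide_distrib)
        ultimately show "((\<lambda>(k1, k2). B k1 k2 * ((of_real \<epsilon> / of_real t) powi (- k1 - 1) *
              (1 / of_real t) powi (- k2 - 1))) has_sum R (of_real (1 + \<epsilon>) / of_real t # 1 / of_real t # zs)) UNIV"
          using B_sum[of "of_real \<epsilon> / of_real t" "1 / of_real t"] t \<epsilon> by (simp add: norm_divide)
        have "cmod (of_real (1 + \<epsilon>) / of_real t) = (1 + \<epsilon>) / t" "cmod (1 / of_real t) = 1 / t"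
          using t \<epsilon> by (simp_all only: norm_divide norm_of_real norm_one abs_of_pos add_pos_pos zero_less_one)
        moreover have "r < 1 / t" "1 / t < (1 + \<epsilon>) / t"
          using small \<epsilon> t by (simp add: pos_less_divide_eq, intro divide_strict_right_mono) auto
        ultimately show "((\<lambda>(k1, k2). T k1 k2 * ((of_real (1 + \<epsilon>) / of_real t) powi (- k1 - 1) *
              (1 / of_real t) powi (- k2 - 1))) has_sum R (of_real (1 + \<epsilon>) / of_real t # 1 / of_real t # zs)) UNIV"
          by (intro T_sum) simp_all
      qed
      \<comment> \<open>The value \<open>s K\<close>, which associativity assigns to the
        antidiagonal sum of \<open>S\<close>, is also that of \<open>T\<close>, hence a Laurent
        coefficient in \<open>t\<close> of the rational limit.\<close>
      have sT: "s K = (\<Sum>\<^sub>\<infinity>k. T k (K - k) * of_real (1 + \<epsilon>) powi (- k - 1))" for K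
        using s by (intro infsumI[symmetric]) blast
      \<comment> \<open>The antidiagonal \<open>K\<close> carries \<open>t powi (K + 2)\<close>,
        hence the shift by 2.\<close>
      have "b (j - 2) = s (j - 2)" for j
      proof (rule laurent_coeffs_unique[OF \<delta>, where M = "min M M' + 2" and a = "\<lambda>j. b (j - 2)" and b = "\<lambda>j. s (j - 2)"])
        show "b (k - 2) = 0" "s (k - 2) = 0" if "k < min M M' + 2" for k
          unfolding b_def sT by (rule infsum_0; use that trunc(2) T_low in simp)+
        fix t :: real assume t: "0 < t" "t < \<delta>"
        then have t0: "complex_of_real t \<noteq> 0" by simp
        show "\<exists>S. ((\<lambda>k. b (k - 2) * of_real t powi k) has_sum S) UNIV \<and>
            ((\<lambda>k. s (k - 2) * of_real t powi k) has_sum S) UNIV"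
          unfolding b_def sT
          by (rule exI, rule conjI, rule has_sum_by_antidiagonals(2)[OF series(1)[OF t] t0],
              rule has_sum_by_antidiagonals(2)[OF series(2)[OF t] t0])
      qed
      from this[of "K + 2"] have "b K = s K" by simp
      moreover have "((\<lambda>k. B k (K - k) * of_real \<epsilon> powi (- k - 1)) has_sum b K) UNIV"
        unfolding b_def
        by (rule has_sum_infsum, rule has_sum_by_antidiagonals(1)[OF series(1)[of "\<delta> / 2"]]) (use \<delta> in auto)
      ultimately show ?thesis using s by auto
    qed
    \<comment> \<open>With \<open>K\<close> fixed, \<open>line\<close> compares two Laurent series
      in \<epsilon>. The substitution \<open>k = - j - 1\<close> turns the upper bounds
      \<open>N\<close> and \<open>N'\<close> on \<open>k\<close> into a lower bound on the exponent
      \<open>j\<close>.\<close>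
    have "S k1 k2 = B k1 k2" for k1 k2
    proof -
      define K where "K = k1 + k2"
      have "S (- j - 1) (K - (- j - 1)) = B (- j - 1) (K - (- j - 1))" for j
      proof (rule laurent_coeffs_unique[where \<delta> = 1 and M = "- max N N' - 1" and
            a = "\<lambda>j. S (- j - 1) (K - (- j - 1))" and b = "\<lambda>j. B (- j - 1) (K - (- j - 1))"])
        show "S (- k - 1) (K - (- k - 1)) = 0" "B (- k - 1) (K - (- k - 1)) = 0" if "k < - max N N' - 1" for k
          by (rule S_up[rule_format] trunc(1)[rule_format]; use that in linarith)+
        fix t :: real assume t: "0 < t" "t < 1"
        have "((\<lambda>j. A (- j - 1) (K - (- j - 1)) * of_real t powi j) has_sum s) UNIV"
          if "((\<lambda>k. A k (K - k) * of_real t powi (- k - 1)) has_sum s) UNIV" for A :: "int \<Rightarrow> int \<Rightarrow> complex" and s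
          by (rule has_sum_reindex_bij_witness[where i = "\<lambda>k. - k - 1" and j = "\<lambda>k. - k - 1", THEN iffD1,
                OF _ _ _ _ _ refl that]) auto
        note reindex = this
        obtain s where "((\<lambda>k. B k (K - k) * of_real t powi (- k - 1)) has_sum s) UNIV"
            "((\<lambda>k. S k (K - k) * of_real t powi (- k - 1)) has_sum s) UNIV"
          using line[OF t] by blast
        then show "\<exists>s. ((\<lambda>k. S (- k - 1) (K - (- k - 1)) * of_real t powi k) has_sum s) UNIV \<and>
            ((\<lambda>k. B (- k - 1) (K - (- k - 1)) * of_real t powi k) has_sum s) UNIV"
          by (intro exI conjI reindex)
      qed simp
      from this[of "- k1 - 1"] show ?thesis by (simp add: K_def)
    qed
    \<comment> \<open>Real arguments sufficed to identify the coefficients, while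
      \<open>B_sum\<close> holds on the whole complex region; so the iterate series converges there
      to the same value.\<close>
    then have "(\<lambda>(k1, k2). S k1 k2 * ((z1 - z2) powi (- k1 - 1) * z2 powi (- k2 - 1))) =
        (\<lambda>(k1, k2). B k1 k2 * ((z1 - z2) powi (- k1 - 1) * z2 powi (- k2 - 1)))"
      by simp
    with B_sum[of "z1 - z2" z2] far' zs(4)
    show "abs_converges_to (\<lambda>ks. pair \<phi> (extend_op W (YL (ks ! 1) (Y (ks ! 0) v1 v2)) (f zs)))
        [z1 - z2, z2] (pair \<phi> (h (z1 # z2 # zs)))"
      by (simp add: abs_converges_to_2 S_def B.iterate_coeff_def R_def)
  qed
qed

end
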